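(* Let $n\ge 2$. For all $a,b\in[n]$ with $a\ge b$, we have $|FC_a|\ge|FC_b|$.
   Context: Identify a monotone lattice path from $(0,0)$ to $(n-k,k)$ with the $k$-subset of $[n]$ of positions of its North steps. For $k$-subsets $U=\{u_1<\dots<u_k\}$, $L=\{\ell_1<\dots<\ell_k\}$ of $[n]$ with $u_i\le\ell_i$ for all $i$, the lattice path matroid $M[U,L]$ is the matroid on $[n]$ whose bases are the $k$-sets $\{b_1<\dots<b_k\}$ with $u_i\le b_i\le\ell_i$. $\mathcal{P}_n$ is the poset of all lattice path matroids on $[n]$ ordered by the matroid quotient relation ($M'\le_q M$ iff there is a matroid $N$ on $[n]\sqcup T$ with $M=N\setminus T$, $M'=N/T$). Known: $M[U',L']\le_q M[U,L]$ iff $U'\subseteq U$, $L'\subseteq L$ and the greedy pairing is good, where: $(\ell_i,u_j)$ is a good pair of $M[U,L]$ if $i\le j$ and $u_j-\ell_i\le j-i$; with $U\setminus U'=\{a_1<\dots<a_z\}$, $L\setminus L'=\{b_1<\dots<b_z\}$, the greedy pairing $((b_1,a_1),\dots,(b_z,a_z))$ is good if each $(b_r,a_r)$ is a good pair of $M[U\setminus\{a_1,\dots,a_{r-1}\},L\setminus\{b_1,\dots,b_{r-1}\}]$. Covers $M[U\setminus\{u\},L\setminus\{\ell\}]\lessdot M[U,L]$ are labeled $(\ell,u)$. A saturated chain $x_0\lessdot\cdots\lessdot x_m$ with labels $(\ell_i,u_i)=\lambda(x_{i-1}\lessdot x_i)$ is falling if for each $1\le i<m$ it is not the case that both $\ell_i<\ell_{i+1}$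 and $u_i<u_{i+1}$. Let $U_{0,n}=M[\emptyset,\emptyset]$ and for $k\in[n]$ let $M_{k,1}=M[[n]\setminus\{k\},[n]\setminus\{1\}]$ (rank $n-1$). $FC_k$ is the set of falling maximal chains of the interval $[U_{0,n},M_{k,1}]$ of $\mathcal{P}_n$. *)

theory Defs
  imports Main
begin

datatype 'a basis_system = Basis_System (ground: "'a set") (bases: "'a set set")

definition matroid :: "'a basis_system \<Rightarrow> bool" where
  "matroid N \<longleftrightarrow>
     finite (ground N) \<and> bases N \<noteq> {} \<and> (\<forall>B\<in>bases N. B \<subseteq> ground N) \<and>
     (\<forall>A\<in>bases N. \<forall>B\<in>bases N. \<forall>x\<in>A - B. \<exists>y\<in>B - A. insert y (A - {x}) \<in> bases N)"

definition indep :: "'a basis_system \<Rightarrow> 'a set \<Rightarrow> bool" where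
  "indep N I \<longleftrightarrow> (\<exists>B\<in>bases N. I \<subseteq> B)"

definition delete :: "'a basis_system \<Rightarrow> 'a set \<Rightarrow> 'a basis_system" where
  "delete N T = Basis_System (ground N - T)
     {I. I \<subseteq> ground N - T \<and> indep N I \<and>
         (\<forall>J. J \<subseteq> ground N - T \<and> indep N J \<and> I \<subseteq> J \<longrightarrow> J = I)}"

definition dual :: "'a basis_system \<Rightarrow> 'a basis_system" where
  "dual N = Basis_System (ground N) ((\<lambda>B. ground N - B) ` bases N)"

definition contract :: "'a basis_system \<Rightarrow> 'a set \<Rightarrow> 'a basis_system" where
  "contract N T = dual (delete (dual N) T)"

text \<open>Over the natural numbers, a finite ground set always leaves room for a disjoint
  \<open>T\<close> of any finite size, so it is no restriction to take \<open>T\<close> inside the same type.\<close>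

definition quotient_of :: "nat basis_system \<Rightarrow> nat basis_system \<Rightarrow> bool" (infix "\<le>\<^sub>q" 50) where
  "M' \<le>\<^sub>q M \<longleftrightarrow>
     (\<exists>N T. matroid N \<and> ground M \<inter> T = {} \<and> ground N = ground M \<union> T \<and>
            M = delete N T \<and> M' = contract N T)"

text \<open>For finite sets, \<open>list_all2\<close> includes equality of cardinalities.\<close>

definition gale_le :: "nat set \<Rightarrow> nat set \<Rightarrow> bool" where
  "gale_le A B \<longleftrightarrow> list_all2 (\<le>) (sorted_list_of_set A) (sorted_list_of_set B)"

definition path_pair :: "nat \<Rightarrow> nat set \<Rightarrow> nat set \<Rightarrow> bool" where
  "path_pair n U L \<longleftrightarrow> U \<subseteq> {1..n} \<and> L \<subseteq> {1..n} \<and> gale_le U L"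

definition lpm :: "nat \<Rightarrow> nat set \<Rightarrow> nat set \<Rightarrow> nat basis_system" where
  "lpm n U L = Basis_System {1..n} {B. B \<subseteq> {1..n} \<and> gale_le U B \<and> gale_le B L}"

definition lpm_poset :: "nat \<Rightarrow> nat basis_system set" where
  "lpm_poset n = {lpm n U L |U L. path_pair n U L}"

definition covered_by :: "nat \<Rightarrow> nat basis_system \<Rightarrow> nat basis_system \<Rightarrow> bool" where
  "covered_by n x y \<longleftrightarrow>
     x \<in> lpm_poset n \<and> y \<in> lpm_poset n \<and> x \<le>\<^sub>q y \<and> x \<noteq> y \<and>
     \<not> (\<exists>z\<in>lpm_poset n. x \<le>\<^sub>q z \<and> x \<noteq> z \<and> z \<le>\<^sub>q y \<and> z \<noteq> y)"

definition has_label :: "nat \<Rightarrow> nat basis_system \<Rightarrow> nat basis_system \<Rightarrow> nat \<times> nat \<Rightarrow> bool" where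
  "has_label n x y = (\<lambda>(l, u). \<exists>U L. path_pair n U L \<and> path_pair n (U - {u}) (L - {l}) \<and>
     u \<in> U \<and> l \<in> L \<and> y = lpm n U L \<and> x = lpm n (U - {u}) (L - {l}))"

definition cover_label :: "nat \<Rightarrow> nat basis_system \<Rightarrow> nat basis_system \<Rightarrow> nat \<times> nat" where
  "cover_label n x y = (THE p. has_label n x y p)"

text \<open>\<open>cover_label\<close> is well defined, because a lattice path matroid determines its two
  bounding paths (its least and greatest basis).\<close>

lemma gale_le_refl: "gale_le A A"
  by (simp add: gale_le_def list.rel_refl)

lemma gale_le_antisym:
  assumes "finite A" "finite B" "gale_le A B" "gale_le B A"
  shows "A = B"
proof -
  have "sorted_list_of_set A = sorted_list_of_set B"
    using assms(3,4) unfolding gale_le_def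
    by (auto simp: list_all2_conv_all_nth intro!: nth_equalityI order.antisym)
  then show ?thesis
    using assms(1,2) by (metis set_sorted_list_of_set)
qed

lemma lpm_inject:
  assumes "path_pair n U L" "path_pair n U' L'" "lpm n U L = lpm n U' L'"
  shows "U = U' \<and> L = L'"
proof -
  have fin: "finite U" "finite L" "finite U'" "finite L'"
    using assms(1,2) by (auto simp: path_pair_def intro: finite_subset)
  have "(B \<subseteq> {1..n} \<and> gale_le U B \<and> gale_le B L) = (B \<subseteq> {1..n} \<and> gale_le U' B \<and> gale_le B L')" for B
    using assms(3) by (auto simp: lpm_def set_eq_iff)
  from this[of U] this[of L] this[of U'] this[of L'] show ?thesis
    using assms(1,2) fin gale_le_antisym gale_le_refl unfolding path_pair_def by metis
qed

lemma has_label_unique: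
  assumes "has_label n x y p" "has_label n x y q"
  shows "p = q"
proof -
  obtain l u l' u' where pq: "p = (l, u)" "q = (l', u')" by fastforce
  from assms(1) obtain U L where 1: "path_pair n U L" "path_pair n (U - {u}) (L - {l})"
    "u \<in> U" "l \<in> L" "y = lpm n U L" "x = lpm n (U - {u}) (L - {l})"
    unfolding has_label_def pq by blast
  from assms(2) obtain U' L' where 2: "path_pair n U' L'" "path_pair n (U' - {u'}) (L' - {l'})"
    "u' \<in> U'" "l' \<in> L'" "y = lpm n U' L'" "x = lpm n (U' - {u'}) (L' - {l'})"
    unfolding has_label_def pq by blast
  have "U = U' \<and> L = L'" using lpm_inject 1 2 by metis
  moreover have "U - {u} = U' - {u'} \<and> L - {l} = L' - {l'}" using lpm_inject 1 2 by metis
  ultimately show ?thesis using 1(3,4) 2(3,4) pq by blast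
qed

lemma cover_label_eq: "has_label n x y p \<Longrightarrow> cover_label n x y = p"
  unfolding cover_label_def by (rule the_equality) (auto intro: has_label_unique)

definition saturated_chain :: "nat \<Rightarrow> nat basis_system list \<Rightarrow> bool" where
  "saturated_chain n xs \<longleftrightarrow> xs \<noteq> [] \<and> set xs \<subseteq> lpm_poset n \<and>
     (\<forall>i. Suc i < length xs \<longrightarrow> covered_by n (xs ! i) (xs ! Suc i))"

definition falling :: "nat \<Rightarrow> nat basis_system list \<Rightarrow> bool" where
  "falling n xs \<longleftrightarrow>
     (\<forall>i. Suc (Suc i) < length xs \<longrightarrow>
        (let (l, u) = cover_label n (xs ! i) (xs ! Suc i);
             (l', u') = cover_label n (xs ! Suc i) (xs ! Suc (Suc i))
         in \<not> (l < l' \<and> u < u')))"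

text \<open>A maximal chain of an interval of the (finite) poset is a saturated chain from its bottom
  to its top.\<close>

definition maximal_chains :: "nat \<Rightarrow> nat basis_system \<Rightarrow> nat basis_system \<Rightarrow> nat basis_system list set" where
  "maximal_chains n x y = {xs. saturated_chain n xs \<and> hd xs = x \<and> last xs = y}"

definition FC :: "nat \<Rightarrow> nat \<Rightarrow> nat basis_system list set" where
  "FC n k = {xs \<in> maximal_chains n (lpm n {} {}) (lpm n ({1..n} - {k}) ({1..n} - {1})).
               falling n xs}"

end

theory Submission imports Defs begin

text \<open>It suffices to inject \<open>FC\<^sub>k\<close> into \<open>FC\<^sub>k\<^sub>+\<^sub>1\<close>. No upper path occurring in a chain of \<open>FC\<^sub>k\<close> has a
  North step at \<open>k\<close>, so the step \<open>k + 1\<close>, wherever it is present, can be moved to \<open>k\<close>. This keeps the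
  number of North steps up to the moved one, raises the upper path and preserves the order of the
  labels, so good pairs stay good and falling chains stay falling.

  That covers are exactly the removals of a good pair comes from a rank description of quotients
  (\<open>r\<^sub>M - r\<^sub>M\<^sub>'\<close> is monotone). Applied to intervals and their complements it gives inequalities between
  the heights of the bounding paths. These make the pair of the least removed North steps good and
  survive its removal; conversely a good pair yields a quotient via a transversal lift.\<close>

section \<open>Matroid rank and quotients\<close>

text \<open>The comparison is one-sided because a good pair bounds \<open>u\<close> from above:
  moving a North step from \<open>k + 1\<close> to \<open>k\<close> cannot hurt, while the inverse
  move increases \<open>u\<close> and can make the pair bad. The obstacle is the quotient relation
  itself. It asserts the existence of some \<open>N\<close>, so it is neither visibly transitive nor
  easy to refute, yet a cover must be recognised in the given chain and again in its image. The rank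
  inequality is transitive and can be tested on chosen pairs of sets. This closes a circle:
  quotient, rank inequality, inequalities between heights, successive removals of good pairs, rank
  inequality, quotient. Only the last arrow is a construction for arbitrary matroids. A single good
  pair has an explicit transversal \<open>N\<close>, which serves to obtain its rank
  inequality.\<close>

lemma matroid_exchange:
  assumes "matroid N" "A \<in> bases N" "B \<in> bases N" "x \<in> A" "x \<notin> B"
  obtains y where "y \<in> B" "y \<notin> A" "insert y (A - {x}) \<in> bases N"
  using assms unfolding matroid_def by (metis DiffE DiffI)

lemma base_finite: "matroid N \<Longrightarrow> B \<in> bases N \<Longrightarrow> finite B"
  unfolding matroid_def by (meson finite_subset)

lemma base_subset_ground: "matroid N \<Longrightarrow> B \<in> bases N \<Longrightarrow> B \<subseteq> ground N"
  unfolding matroid_def by blast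

lemma indep_subset_ground: "matroid N \<Longrightarrow> indep N I \<Longrightarrow> I \<subseteq> ground N"
  unfolding indep_def using base_subset_ground by fast

lemma indep_finite: "matroid N \<Longrightarrow> indep N I \<Longrightarrow> finite I"
  unfolding indep_def using base_finite finite_subset by metis

lemma indep_mono: "indep N J \<Longrightarrow> I \<subseteq> J \<Longrightarrow> indep N I"
  unfolding indep_def by blast

lemma base_indep: "B \<in> bases N \<Longrightarrow> indep N B"
  unfolding indep_def by blast

lemma indep_empty: "matroid N \<Longrightarrow> indep N {}"
  unfolding indep_def matroid_def by blast

text \<open>Exchanging towards \<open>B\<close> shrinks \<open>A - B\<close> at constant cardinality
  until \<open>A \<subseteq> B\<close>. Proper inclusion is impossible, since an exchange from
  \<open>B\<close> into \<open>A\<close> would find no replacement.\<close>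

lemma bases_card_eq:
  assumes "matroid N" "A \<in> bases N" "B \<in> bases N"
  shows "card A = card B"
  using assms(2)
proof (induction "card (A - B)" arbitrary: A rule: less_induct)
  case less
  show ?case
  proof (cases "A \<subseteq> B")
    case True
    moreover have "B \<subseteq> A"
    proof (rule ccontr)
      assume "\<not> B \<subseteq> A"
      then obtain y where y: "y \<in> B" "y \<notin> A" by blast
      show False
        using matroid_exchange[OF assms(1,3) less.prems y] True by blast
    qed
    ultimately show ?thesis by simp
  next
    case False
    then obtain x where x: "x \<in> A" "x \<notin> B" by blast
    then obtain y where y: "y \<in> B" "y \<notin> A" "insert y (A - {x}) \<in> bases N"
      using matroid_exchange[OF assms(1) less.prems assms(3)] by blast
    have fin: "finite A" using base_finite assms(1) less.prems by blast
    have "insert y (A - {x}) - B \<subset> A - B" using x y by auto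
    then have "card (insert y (A - {x}) - B) < card (A - B)"
      using fin by (intro psubset_card_mono) auto
    from less.hyps[OF this y(3)] have "card (insert y (A - {x})) = card B" .
    moreover have "card (insert y (A - {x})) = card A"
      using card_insert_disjoint[of "A - {x}" y] card_Suc_Diff1[OF fin x(1)] fin y(2) by simp
    ultimately show ?thesis by simp
  qed
qed

text \<open>Among the bases containing \<open>I\<close>, one with the largest intersection with
  \<open>B\<close> works: an element outside \<open>I \<union> B\<close> could be exchanged for one
  of \<open>B\<close>, enlarging the intersection.\<close>

lemma indep_extend_base:
  assumes N: "matroid N" and I: "indep N I" and B: "B \<in> bases N"
  obtains A where "A \<in> bases N" "I \<subseteq> A" "A \<subseteq> I \<union> B"
proof -
  let ?P = "\<lambda>A. A \<in> bases N \<and> I \<subseteq> A"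
  have "\<exists>A. ?P A" using I unfolding indep_def by blast
  moreover have "\<forall>A. ?P A \<longrightarrow> card (A \<inter> B) < Suc (card B)"
    using base_finite[OF N B] by (simp add: card_mono less_Suc_eq_le)
  ultimately obtain A where A: "?P A" and mx: "\<forall>A'. ?P A' \<longrightarrow> card (A' \<inter> B) \<le> card (A \<inter> B)"
    using ex_has_greatest_nat[of ?P _ "\<lambda>A. card (A \<inter> B)" "Suc (card B)"] by (metis less_imp_le)
  have "A \<subseteq> I \<union> B"
  proof (rule ccontr)
    assume "\<not> A \<subseteq> I \<union> B"
    then obtain x where x: "x \<in> A" "x \<notin> B" "x \<notin> I" by blast
    then obtain y where y: "y \<in> B" "y \<notin> A" "insert y (A - {x}) \<in> bases N"
      using matroid_exchange[OF N _ B] A by blast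
    have "insert y (A - {x}) \<inter> B = insert y (A \<inter> B)" using x y by blast
    moreover have "finite (A \<inter> B)" using base_finite[OF N B] by simp
    ultimately have "card (insert y (A - {x}) \<inter> B) = Suc (card (A \<inter> B))" using y by simp
    moreover have "?P (insert y (A - {x}))" using A x y by blast
    ultimately show False using mx by fastforce
  qed
  then show ?thesis using A that by blast
qed

text \<open>Extend \<open>I\<close> to a base \<open>A\<close> using only elements of a base
  \<open>B\<close> containing \<open>J\<close>. As bases are equicardinal, \<open>A - I\<close> is
  larger than \<open>B - J\<close>, so it contains an element of \<open>J\<close>.\<close>

lemma indep_augment:
  assumes N: "matroid N" and I: "indep N I" and J: "indep N J" and lt: "card I < card J"
  obtains x where "x \<in> J" "x \<notin> I" "indep N (insert x I)"
proof -
  obtain B where B: "B \<in> bases N" "J \<subseteq> B" using J unfolding indep_def by blast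
  obtain A where A: "A \<in> bases N" "I \<subseteq> A" "A \<subseteq> I \<union> B"
    using indep_extend_base[OF N I B(1)] by blast
  note fin = base_finite[OF N A(1)] base_finite[OF N B(1)]
  have "\<not> A - I \<subseteq> B - J"
  proof
    assume "A - I \<subseteq> B - J"
    then have "card (A - I) \<le> card (B - J)" using fin by (intro card_mono) auto
    moreover have "card (A - I) = card A - card I" "card I \<le> card A"
      using A(2) fin by (simp_all add: card_Diff_subset finite_subset card_mono)
    moreover have "card (B - J) = card B - card J" "card J \<le> card B"
      using B(2) fin by (simp_all add: card_Diff_subset finite_subset card_mono)
    ultimately show False using lt bases_card_eq[OF N A(1) B(1)] by linarith
  qed
  then obtain x where "x \<in> A" "x \<notin> I" "x \<in> J" using A(3) by blast
  then show ?thesis using that A unfolding indep_def by (meson insert_subsetI)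
qed

section \<open>Rank function\<close>

definition rk :: "'a basis_system \<Rightarrow> 'a set \<Rightarrow> nat" where
  "rk N X = Max (card ` {I. I \<subseteq> X \<and> indep N I})"

lemma finite_indeps: "matroid N \<Longrightarrow> finite {I. I \<subseteq> X \<and> indep N I}"
  by (rule finite_subset[of _ "Pow (ground N)"]) (use indep_subset_ground in \<open>auto simp: matroid_def\<close>)

lemma card_le_rk: "matroid N \<Longrightarrow> indep N I \<Longrightarrow> I \<subseteq> X \<Longrightarrow> card I \<le> rk N X"
  unfolding rk_def using finite_indeps by (intro Max_ge) blast+

lemma rk_attained:
  assumes "matroid N"
  obtains I where "I \<subseteq> X" "indep N I" "card I = rk N X"
proof -
  have "rk N X \<in> card ` {I. I \<subseteq> X \<and> indep N I}"
    unfolding rk_def using finite_indeps[OF assms] indep_empty[OF assms]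
    by (intro Max_in) blast+
  then obtain I where "rk N X = card I" "I \<subseteq> X" "indep N I" by blast
  then show ?thesis using that by simp
qed

lemma rk_le_iff: "matroid N \<Longrightarrow> rk N X \<le> m \<longleftrightarrow> (\<forall>I. I \<subseteq> X \<and> indep N I \<longrightarrow> card I \<le> m)"
proof
  assume "rk N X \<le> m" and "matroid N"
  then show "\<forall>I. I \<subseteq> X \<and> indep N I \<longrightarrow> card I \<le> m" using card_le_rk le_trans by blast
next
  assume *: "\<forall>I. I \<subseteq> X \<and> indep N I \<longrightarrow> card I \<le> m" and "matroid N"
  from rk_attained[OF this(2), of X] obtain I where "I \<subseteq> X" "indep N I" "card I = rk N X" .
  with * show "rk N X \<le> m" by metis
qed

lemma rk_mono: "matroid N \<Longrightarrow> X \<subseteq> Y \<Longrightarrow> rk N X \<le> rk N Y"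
  unfolding rk_le_iff using card_le_rk by blast

lemma rk_empty: "matroid N \<Longrightarrow> rk N {} = 0"
  using rk_le_iff[of N "{}" 0] by auto

lemma rk_indep: "matroid N \<Longrightarrow> indep N I \<Longrightarrow> rk N I = card I"
  by (simp add: antisym card_le_rk rk_le_iff card_mono indep_finite)

lemma indep_if_rk:
  assumes "matroid N" "finite I" "card I \<le> rk N I"
  shows "indep N I"
proof -
  obtain J where "J \<subseteq> I" "indep N J" "card J = rk N I" using rk_attained assms(1) by metis
  then show ?thesis using assms(2,3) card_seteq[of I J] by simp
qed

lemma rk_ground: "matroid N \<Longrightarrow> B \<in> bases N \<Longrightarrow> rk N (ground N) = card B"
proof (rule antisym)
  assume N: "matroid N" and B: "B \<in> bases N"
  show "card B \<le> rk N (ground N)"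
    using card_le_rk[OF N base_indep[OF B] base_subset_ground[OF N B]] .
  have "card I \<le> card B" if "indep N I" for I
  proof -
    obtain A where "A \<in> bases N" "I \<subseteq> A" using \<open>indep N I\<close> unfolding indep_def by blast
    then show ?thesis using bases_card_eq[OF N _ B] card_mono[OF base_finite[OF N]] by metis
  qed
  then show "rk N (ground N) \<le> card B" unfolding rk_le_iff[OF N] by blast
qed

lemma base_iff:
  assumes "matroid N"
  shows "B \<in> bases N \<longleftrightarrow> indep N B \<and> card B = rk N (ground N)"
proof
  assume "indep N B \<and> card B = rk N (ground N)"
  moreover then obtain A where "A \<in> bases N" "B \<subseteq> A" unfolding indep_def by blast
  ultimately show "B \<in> bases N"
    using rk_ground[OF assms, of A] card_subset_eq[OF base_finite[OF assms, of A], of B] by simp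
qed (simp add: assms rk_ground base_indep)

lemma indep_extend_rk:
  assumes N: "matroid N" and "indep N I" "I \<subseteq> X"
  obtains J where "I \<subseteq> J" "J \<subseteq> X" "indep N J" "card J = rk N X"
  using assms(2,3)
proof (induction "rk N X - card I" arbitrary: I thesis rule: less_induct)
  case less
  show ?case
  proof (cases "card I = rk N X")
    case True
    then show ?thesis using less.prems(1)[OF subset_refl less.prems(3,2)] by simp
  next
    case False
    then have lt: "card I < rk N X" using card_le_rk[OF N less.prems(2,3)] by simp
    obtain K where K: "K \<subseteq> X" "indep N K" "card K = rk N X" using rk_attained[OF N] .
    obtain x where x: "x \<in> K" "x \<notin> I" "indep N (insert x I)"
      using indep_augment[OF N less.prems(2) K(2)] lt K(3) by metis
    have "rk N X - card (insert x I) < rk N X - card I"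
      using lt x indep_finite[OF N less.prems(2)] by simp
    then obtain J where "insert x I \<subseteq> J" "J \<subseteq> X" "indep N J" "card J = rk N X"
      using less.hyps[of "insert x I"] x K(1) less.prems(3) by blast
    then show ?thesis using less.prems(1) by blast
  qed
qed

lemma rk_submodular:
  assumes N: "matroid N"
  shows "rk N (X \<union> Y) + rk N (X \<inter> Y) \<le> rk N X + rk N Y"
proof -
  obtain I where I: "I \<subseteq> X \<inter> Y" "indep N I" "card I = rk N (X \<inter> Y)" using rk_attained[OF N] .
  obtain J where J: "I \<subseteq> J" "J \<subseteq> X \<union> Y" "indep N J" "card J = rk N (X \<union> Y)"
    using indep_extend_rk[OF N I(2), of "X \<union> Y"] I(1) by blast
  have fin: "finite J" using indep_finite[OF N J(3)] .
  have "card I \<le> card (J \<inter> (X \<inter> Y))" using I J fin by (intro card_mono) auto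
  moreover have "card (J \<inter> X) + card (J \<inter> Y) = card J + card (J \<inter> (X \<inter> Y))"
  proof -
    have "(J \<inter> X) \<union> (J \<inter> Y) = J" "(J \<inter> X) \<inter> (J \<inter> Y) = J \<inter> (X \<inter> Y)" using J(2) by blast+
    then show ?thesis using card_Un_Int[of "J \<inter> X" "J \<inter> Y"] fin by simp
  qed
  moreover have "card (J \<inter> X) \<le> rk N X" "card (J \<inter> Y) \<le> rk N Y"
    using card_le_rk[OF N indep_mono[OF J(3)]] by simp_all
  ultimately show ?thesis using I J by linarith
qed

section \<open>Ranks and bases of deletions and contractions\<close>

lemma ground_delete: "ground (delete N T) = ground N - T"
  by (simp add: delete_def)

lemma ground_contract: "ground (contract N T) = ground N - T"
  by (simp add: contract_def delete_def dual_def)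

lemma indep_delete:
  assumes N: "matroid N"
  shows "indep (delete N T) I \<longleftrightarrow> I \<subseteq> ground N - T \<and> indep N I"
proof
  assume "indep (delete N T) I"
  then obtain B where "B \<in> bases (delete N T)" "I \<subseteq> B" unfolding indep_def by blast
  moreover from this(1) have "B \<subseteq> ground N - T" "indep N B" unfolding delete_def by simp_all
  ultimately show "I \<subseteq> ground N - T \<and> indep N I" using indep_mono[of N B I] by blast
next
  assume I: "I \<subseteq> ground N - T \<and> indep N I"
  then obtain J where J: "I \<subseteq> J" "J \<subseteq> ground N - T" "indep N J" "card J = rk N (ground N - T)"
    using indep_extend_rk[OF N, of I "ground N - T"] by blast
  have "K = J" if "K \<subseteq> ground N - T" "indep N K" "J \<subseteq> K" for K
    using card_le_rk[OF N that(2,1)] that(3) J(4) indep_finite[OF N that(2)]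
    by (metis card_seteq[of K J])
  then have "J \<in> bases (delete N T)" using J unfolding delete_def by simp
  then show "indep (delete N T) I" using J(1) unfolding indep_def by blast
qed

lemma rk_delete:
  assumes "matroid N" "X \<subseteq> ground N - T"
  shows "rk (delete N T) X = rk N X"
proof -
  have "{I. I \<subseteq> X \<and> indep (delete N T) I} = {I. I \<subseteq> X \<and> indep N I}"
    using assms(2) by (auto simp: indep_delete[OF assms(1)])
  then show ?thesis by (simp add: rk_def)
qed

text \<open>The base \<open>B\<^sub>0\<close> avoiding \<open>T\<close> ensures that deletion does
  not lower the rank: a maximal independent set avoiding \<open>T\<close> extends by elements of
  \<open>B\<^sub>0\<close> to a base, hence is one.\<close>

lemma bases_delete:
  assumes N: "matroid N" and ex: "B\<^sub>0 \<in> bases N" "B\<^sub>0 \<inter> T = {}"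
  shows "bases (delete N T) = {B \<in> bases N. B \<inter> T = {}}"
proof -
  have sub: "B \<subseteq> ground N - T" if "B \<in> bases N" "B \<inter> T = {}" for B
    using that base_subset_ground[OF N] by blast
  have "B \<in> bases N \<and> B \<inter> T = {}" if B: "B \<in> bases (delete N T)" for B
  proof -
    have "B \<subseteq> ground N - T" "indep N B"
      and mx: "\<And>J. J \<subseteq> ground N - T \<Longrightarrow> indep N J \<Longrightarrow> B \<subseteq> J \<Longrightarrow> J = B"
      using B by (auto simp: delete_def)
    then obtain A where A: "A \<in> bases N" "B \<subseteq> A" "A \<subseteq> B \<union> B\<^sub>0"
      using indep_extend_base[OF N _ ex(1)] by metis
    then have "A = B" using mx[of A] base_indep sub[OF ex] \<open>B \<subseteq> ground N - T\<close> by blast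
    then show ?thesis using A(1) \<open>B \<subseteq> ground N - T\<close> by blast
  qed
  moreover have "B \<in> bases (delete N T)" if B: "B \<in> bases N" "B \<inter> T = {}" for B
  proof -
    have "J = B" if "indep N J" "B \<subseteq> J" for J
      using that B(1) N by (metis base_iff card_le_rk card_seteq indep_finite indep_subset_ground)
    then show ?thesis using sub[OF B] base_indep[OF B(1)] by (auto simp: delete_def)
  qed
  ultimately show ?thesis by blast
qed

text \<open>\<open>contract\<close> is deletion in the dual, so its bases are the inclusion-minimal
  sets \<open>B - T\<close>. Since bases are equicardinal, minimality means that
  \<open>B \<inter> T\<close> is as large as possible.\<close>

lemma bases_contract:
  assumes N: "matroid N" and T: "T \<subseteq> ground N"
  shows "bases (contract N T) = {B - T |B. B \<in> bases N \<and> card (B \<inter> T) = rk N T}"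
proof -
  let ?E = "ground N - T"
  have coindep: "indep (dual N) I \<longleftrightarrow> (\<exists>B\<in>bases N. I \<subseteq> ground N - B)" for I
    by (auto simp: indep_def dual_def)
  define maxl where "maxl I \<longleftrightarrow> (\<forall>J. J \<subseteq> ?E \<and> indep (dual N) J \<and> I \<subseteq> J \<longrightarrow> J = I)" for I
  have bc: "bases (contract N T) = (\<lambda>I. ?E - I) ` {I. I \<subseteq> ?E \<and> indep (dual N) I \<and> maxl I}"
    by (simp add: contract_def delete_def dual_def maxl_def)
  have split: "card B = card (B \<inter> T) + card (B - T)" if "B \<in> bases N" for B
    using base_finite[OF N that] by (metis Int_Diff_disjoint Int_Diff_Un card_Un_disjoint finite_Diff finite_Int)
  have le: "card (B \<inter> T) \<le> rk N T" if "B \<in> bases N" for B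
    using card_le_rk[OF N] base_indep[OF that] indep_mono by (metis inf_le1 inf_le2)
  show ?thesis unfolding bc
  proof (intro equalityI subsetI)
    fix C assume "C \<in> (\<lambda>I. ?E - I) ` {I. I \<subseteq> ?E \<and> indep (dual N) I \<and> maxl I}"
    then obtain I where C: "C = ?E - I" and I: "I \<subseteq> ?E" "indep (dual N) I" "maxl I" by blast
    from I(3) have mx: "J = I" if "J \<subseteq> ?E" "indep (dual N) J" "I \<subseteq> J" for J
      using that unfolding maxl_def by blast
    obtain B where B: "B \<in> bases N" "I \<subseteq> ground N - B" using I(2) coindep by blast
    have "?E - B = I" using mx[of "?E - B"] B I(1) unfolding coindep by blast
    then have CB: "C = B - T" using C base_subset_ground[OF N B(1)] by blast
    have "card (B \<inter> T) = rk N T"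
    proof (rule ccontr)
      assume "card (B \<inter> T) \<noteq> rk N T"
      then have lt: "card (B \<inter> T) < rk N T" using le[OF B(1)] by simp
      \<comment> \<open>Complete \<open>B \<inter> T\<close> inside \<open>T\<close>, then to a base
        by elements of \<open>B\<close>. The new base has a strictly smaller part outside
        \<open>T\<close>, against the maximality of \<open>I\<close>.\<close>
      obtain J where J: "B \<inter> T \<subseteq> J" "J \<subseteq> T" "indep N J" "card J = rk N T"
        using indep_extend_rk[OF N indep_mono[OF base_indep[OF B(1)]], of "B \<inter> T" T] by auto
      obtain B' where B': "B' \<in> bases N" "J \<subseteq> B'" "B' \<subseteq> J \<union> B"
        using indep_extend_base[OF N J(3) B(1)] .
      have "card J \<le> card (B' \<inter> T)"
        using J(2) B' base_finite[OF N B'(1)] by (intro card_mono) auto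
      then have "card (B' - T) < card (B - T)"
        using split[OF B(1)] split[OF B'(1)] lt J(4) bases_card_eq[OF N B(1) B'(1)] by linarith
      moreover have "?E - B' = I" using mx[of "?E - B'"] B'(1,3) J(2) \<open>?E - B = I\<close>
        unfolding coindep by blast
      then have "B' - T = B - T"
        using \<open>?E - B = I\<close> base_subset_ground[OF N B(1)] base_subset_ground[OF N B'(1)] by blast
      ultimately show False by simp
    qed
    then show "C \<in> {B - T |B. B \<in> bases N \<and> card (B \<inter> T) = rk N T}" using B CB by blast
  next
    fix C assume "C \<in> {B - T |B. B \<in> bases N \<and> card (B \<inter> T) = rk N T}"
    then obtain B where C: "C = B - T" and B: "B \<in> bases N" "card (B \<inter> T) = rk N T" by blast
    have "J = ?E - B" if J: "J \<subseteq> ?E" "indep (dual N) J" "?E - B \<subseteq> J" for J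
    proof -
      obtain A where A: "A \<in> bases N" "J \<subseteq> ground N - A" using J(2) coindep by blast
      have sub: "A - T \<subseteq> B - T" using J A base_subset_ground[OF N A(1)] by blast
      have "card (B - T) \<le> card (A - T)"
        using split[OF A(1)] split[OF B(1)] le[OF A(1)] B(2) bases_card_eq[OF N A(1) B(1)] by linarith
      then have "A - T = B - T" using sub card_seteq base_finite[OF N B(1)] by blast
      then show ?thesis using J A by blast
    qed
    then have "maxl (?E - B)" unfolding maxl_def by blast
    moreover have "indep (dual N) (?E - B)" using B(1) coindep by blast
    moreover have "C = ?E - (?E - B)" using C base_subset_ground[OF N B(1)] by blast
    ultimately show "C \<in> (\<lambda>I. ?E - I) ` {I. I \<subseteq> ?E \<and> indep (dual N) I \<and> maxl I}" by blast
  qed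
qed

text \<open>Together with the next lemma this is the rank formula r(X \<union> T) - r(T) for the
  contraction. Phrased with bases, it does not presuppose that the contraction is a matroid.\<close>

lemma card_contract_base_le:
  assumes N: "matroid N" and T: "T \<subseteq> ground N" and X: "X \<subseteq> ground N - T"
    and C: "C \<in> bases (contract N T)"
  shows "card (C \<inter> X) + rk N T \<le> rk N (X \<union> T)"
proof -
  obtain B where B: "C = B - T" "B \<in> bases N" "card (B \<inter> T) = rk N T"
    using C unfolding bases_contract[OF N T] by blast
  have "card (B \<inter> (X \<union> T)) = card (C \<inter> X) + card (B \<inter> T)"
  proof -
    have "B \<inter> (X \<union> T) = (C \<inter> X) \<union> (B \<inter> T)" "(C \<inter> X) \<inter> (B \<inter> T) = {}" using B(1) X by blast+
    then show ?thesis using card_Un_disjoint base_finite[OF N B(2)] B(1)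
      by (metis finite_Diff finite_Int)
  qed
  then show ?thesis
    using card_le_rk[OF N indep_mono[OF base_indep[OF B(2)]], of "B \<inter> (X \<union> T)" "X \<union> T"] B(3) by simp
qed

text \<open>Building the base greedily, first in \<open>T\<close>, then in
  \<open>X \<union> T\<close>, gives it full rank on both sets.\<close>

lemma contract_base_attains_rk:
  assumes N: "matroid N" and T: "T \<subseteq> ground N" and X: "X \<subseteq> ground N - T"
  obtains C where "C \<in> bases (contract N T)" "card (C \<inter> X) + rk N T = rk N (X \<union> T)"
proof -
  obtain J where J: "J \<subseteq> T" "indep N J" "card J = rk N T" using rk_attained[OF N] .
  obtain K where K: "J \<subseteq> K" "K \<subseteq> X \<union> T" "indep N K" "card K = rk N (X \<union> T)"
    using indep_extend_rk[OF N J(2), of "X \<union> T"] J(1) by blast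
  obtain B where B: "B \<in> bases N" "K \<subseteq> B" using K(3) unfolding indep_def by blast
  note fin = base_finite[OF N B(1)]
  have "card (B \<inter> T) \<le> rk N T"
    using card_le_rk[OF N indep_mono[OF base_indep[OF B(1)]], of "B \<inter> T" T] by simp
  then have JB: "B \<inter> T = J" using J K(1) B(2) fin card_seteq[of "B \<inter> T" J] by (metis finite_Int le_inf_iff subset_trans)
  then have C: "B - T \<in> bases (contract N T)" unfolding bases_contract[OF N T] using B(1) J(3) by blast
  have "K = ((B - T) \<inter> X) \<inter> K \<union> J" using K JB B(2) by blast
  then have "card K \<le> card ((B - T) \<inter> X \<inter> K) + card J" by (metis card_Un_le)
  also have "card ((B - T) \<inter> X \<inter> K) \<le> card ((B - T) \<inter> X)" using fin by (intro card_mono) auto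
  finally have "rk N (X \<union> T) \<le> card ((B - T) \<inter> X) + rk N T" using K(4) J(3) by simp
  then show ?thesis using that[OF C] card_contract_base_le[OF N T X C] by simp
qed

section \<open>Quotients in terms of rank\<close>

text \<open>The inequality is kept additive because subtraction on \<open>nat\<close>
  truncates.\<close>

definition rank_quotient :: "'a basis_system \<Rightarrow> 'a basis_system \<Rightarrow> bool" where
  "rank_quotient M' M \<longleftrightarrow> ground M' = ground M \<and>
     (\<forall>X Y. X \<subseteq> Y \<and> Y \<subseteq> ground M \<longrightarrow> rk M' Y + rk M X \<le> rk M Y + rk M' X)"

lemma rank_quotient_refl: "rank_quotient M M"
  by (simp add: rank_quotient_def)

lemma rank_quotient_trans:
  assumes "rank_quotient M'' M'" "rank_quotient M' M"
  shows "rank_quotient M'' M"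
  unfolding rank_quotient_def
proof (intro conjI allI impI)
  show "ground M'' = ground M" using assms by (simp add: rank_quotient_def)
  fix X Y assume "X \<subseteq> Y \<and> Y \<subseteq> ground M"
  then have "rk M'' Y + rk M' X \<le> rk M' Y + rk M'' X" "rk M' Y + rk M X \<le> rk M Y + rk M' X"
    using assms by (simp_all add: rank_quotient_def)
  then show "rk M'' Y + rk M X \<le> rk M Y + rk M'' X" by linarith
qed

text \<open>By the rank formula for contractions, the claim is submodularity of \<open>N\<close> for
  \<open>Y\<close> and \<open>X \<union> T\<close>, whose union is \<open>Y \<union> T\<close> and
  whose intersection is \<open>X\<close>.\<close>

lemma quotient_imp_rank_quotient:
  assumes "M' \<le>\<^sub>q M" "matroid M'"
  shows "rank_quotient M' M"
proof -
  obtain N T where N: "matroid N" and T: "ground M \<inter> T = {}" "ground N = ground M \<union> T"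
    and M: "M = delete N T" and M': "M' = contract N T"
    using assms(1) unfolding quotient_of_def by blast
  have E: "ground N - T = ground M" "T \<subseteq> ground N" using T by blast+
  have rk': "rk M' X + rk N T = rk N (X \<union> T)" if X: "X \<subseteq> ground M" for X
  proof (rule antisym)
    obtain I where I: "I \<subseteq> X" "indep M' I" "card I = rk M' X" using rk_attained[OF assms(2)] .
    then obtain C where C: "C \<in> bases M'" "I \<subseteq> C" unfolding indep_def by blast
    have "card I \<le> card (C \<inter> X)"
      using C I base_finite[OF assms(2) C(1)] by (intro card_mono) auto
    then show "rk M' X + rk N T \<le> rk N (X \<union> T)"
      using card_contract_base_le[OF N E(2), of X C] X E(1) C(1) M' I(3) by simp
    obtain D where D: "D \<in> bases M'" "card (D \<inter> X) + rk N T = rk N (X \<union> T)"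
      using contract_base_attains_rk[OF N E(2), of X] X E(1) M' by metis
    then show "rk N (X \<union> T) \<le> rk M' X + rk N T"
      using card_le_rk[OF assms(2) indep_mono[OF base_indep[OF D(1)]], of "D \<inter> X" X] by simp
  qed
  show ?thesis unfolding rank_quotient_def
  proof (intro conjI allI impI)
    show "ground M' = ground M" using M' E(1) by (simp add: ground_contract)
    fix X Y assume XY: "X \<subseteq> Y \<and> Y \<subseteq> ground M"
    then have X: "X \<subseteq> ground M" and "Y \<union> (X \<union> T) = Y \<union> T" "Y \<inter> (X \<union> T) = X" using T(1) by blast+
    then have "rk N (Y \<union> T) + rk N X \<le> rk N Y + rk N (X \<union> T)"
      using rk_submodular[OF N, of Y "X \<union> T"] by simp
    moreover have "rk M X = rk N X" "rk M Y = rk N Y"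
      using XY E(1) rk_delete[OF N] M by auto
    ultimately show "rk M' Y + rk M X \<le> rk M Y + rk M' X" using rk'[OF X] rk'[of Y] XY by simp
  qed
qed

lemma rk_insert_le:
  assumes "matroid N"
  shows "rk N (insert x X) \<le> Suc (rk N X)"
  unfolding rk_le_iff[OF assms]
proof (intro allI impI)
  fix I assume I: "I \<subseteq> insert x X \<and> indep N I"
  then have "card (I - {x}) \<le> rk N X"
    using card_le_rk[OF assms indep_mono, of I "I - {x}" X] by blast
  then show "card I \<le> Suc (rk N X)" by (simp add: card_Diff_singleton_if split: if_splits)
qed

text \<open>The matroid \<open>N\<close> is Higgs' major of the quotient; the new elements \<open>T\<close> are interchangeable.\<close>

lemma rank_quotient_imp_quotient:
  assumes M: "matroid M" and M': "matroid M'" and q: "rank_quotient M' M"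
  shows "M' \<le>\<^sub>q M"
proof -
  let ?E = "ground M"
  have E': "ground M' = ?E" using q by (simp add: rank_quotient_def)
  have qrk: "rk M' Y + rk M X \<le> rk M Y + rk M' X" if "X \<subseteq> Y" "Y \<subseteq> ?E" for X Y
    using q that by (simp add: rank_quotient_def)
  have finE: "finite ?E" using M by (simp add: matroid_def)
  have "infinite (UNIV - ?E)" using finE by simp
  \<comment> \<open>The size is the rank drop, since a base of \<open>M'\<close> together with
    \<open>T\<close> has to be a base of \<open>N\<close>.\<close>
  then obtain T where T: "finite T" "card T = rk M ?E - rk M' ?E" "T \<subseteq> UNIV - ?E"
    using infinite_arbitrarily_large by metis
  have disj: "?E \<inter> T = {}" using T(3) by blast
  have rkle: "rk M' ?E \<le> rk M ?E" using qrk[of "{}" ?E] rk_empty[OF M] rk_empty[OF M'] by simp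
  define spans where "spans X \<longleftrightarrow> rk M' X = rk M' ?E" for X
  have spans_mono: "spans Y" if "spans X" "X \<subseteq> Y" "Y \<subseteq> ?E" for X Y
    using that rk_mono[OF M' that(2)] rk_mono[OF M' that(3)] unfolding spans_def by simp
  \<comment> \<open>Sets independent in \<open>M\<close> and spanning in \<open>M'\<close> are
    padded by \<open>T\<close> up to the rank of \<open>M\<close>. Those without padding are the
    bases of \<open>M\<close>; those using all of \<open>T\<close> come from the bases of
    \<open>M'\<close>.\<close>
  define N where "N = Basis_System (?E \<union> T)
    {A. A \<subseteq> ?E \<union> T \<and> indep M (A \<inter> ?E) \<and> spans (A \<inter> ?E) \<and> card A = rk M ?E}"
  have gN: "ground N = ?E \<union> T" by (simp add: N_def)
  have bN: "A \<in> bases N \<longleftrightarrow>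
      A \<subseteq> ?E \<union> T \<and> indep M (A \<inter> ?E) \<and> spans (A \<inter> ?E) \<and> card A = rk M ?E" for A
    by (simp add: N_def)
  have split: "card A = card (A \<inter> ?E) + card (A \<inter> T)" if "A \<subseteq> ?E \<union> T" for A
  proof -
    have "A = (A \<inter> ?E) \<union> (A \<inter> T)" "(A \<inter> ?E) \<inter> (A \<inter> T) = {}" using that disj by blast+
    then show ?thesis using card_Un_disjoint[of "A \<inter> ?E" "A \<inter> T"] finE T(1) by simp
  qed
  have base_spans: "spans B" if "B \<in> bases M" for B
    using qrk[OF base_subset_ground[OF M that] subset_refl] rk_mono[OF M' base_subset_ground[OF M that]]
      base_iff[OF M] rk_indep[OF M base_indep[OF that]] that
    unfolding spans_def by simp
  have base_indep': "indep M B" if "B \<in> bases M'" for B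
  proof -
    have "B \<subseteq> ?E" using base_subset_ground[OF M' that] E' by simp
    then show ?thesis
      using qrk[of "{}" B] rk_indep[OF M' base_indep[OF that]] rk_empty[OF M] rk_empty[OF M']
        indep_if_rk[OF M base_finite[OF M' that]] by simp
  qed
  have base_of_M: "A \<in> bases N \<and> A \<inter> T = {} \<longleftrightarrow> A \<in> bases M" for A
  proof
    assume A: "A \<in> bases N \<and> A \<inter> T = {}"
    then have "A \<inter> ?E = A" using bN by blast
    then show "A \<in> bases M" using A unfolding bN base_iff[OF M] by simp
  next
    assume A: "A \<in> bases M"
    then have "A \<inter> ?E = A" "A \<inter> T = {}" "A \<subseteq> ?E \<union> T" using base_subset_ground[OF M A] disj by blast+
    then show "A \<in> bases N \<and> A \<inter> T = {}"
      using A base_spans[OF A] unfolding bN base_iff[OF M] by simp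
  qed
  have lift_base: "B \<union> T \<in> bases N" if B: "B \<in> bases M'" for B
  proof -
    have sub: "B \<subseteq> ?E" using base_subset_ground[OF M' B] E' by simp
    then have "(B \<union> T) \<inter> ?E = B" "(B \<union> T) \<inter> T = T" using disj by blast+
    moreover have "card B = rk M' ?E" using B base_iff[OF M'] E' by simp
    moreover have "spans B" using \<open>card B = rk M' ?E\<close> rk_indep[OF M' base_indep[OF B]]
      by (simp add: spans_def)
    moreover have "B \<union> T \<subseteq> ?E \<union> T" using sub by blast
    ultimately show ?thesis using base_indep'[OF B] split[of "B \<union> T"] T(2) rkle unfolding bN by simp
  qed
  have "matroid N"
    unfolding matroid_def
  proof (intro conjI ballI)
    show "finite (ground N)" using gN finE T(1) by simp
    show "bases N \<noteq> {}" using base_of_M M unfolding matroid_def by blast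
    show "B \<subseteq> ground N" if "B \<in> bases N" for B using that bN gN by simp
    fix A1 A2 x assume A1: "A1 \<in> bases N" and A2: "A2 \<in> bases N" and x: "x \<in> A1 - A2"
    let ?R = "A1 - {x}"
    have finA: "finite A1" "finite A2" using A1 A2 bN finE T(1) by (meson finite_UnI finite_subset)+
    have iR: "indep M (?R \<inter> ?E)" using A1 bN indep_mono[of M "A1 \<inter> ?E" "?R \<inter> ?E"] by blast
    have cR: "Suc (card ?R) = rk M ?E" 
    proof -
      have "x \<in> A1" "card A1 = rk M ?E" using x A1 bN by blast+
      then show ?thesis using card_Suc_Diff1[OF finA(1)] by metis
    qed
    have base: "insert y ?R \<in> bases N"
      if "y \<in> A2" "y \<notin> A1" "indep M (insert y ?R \<inter> ?E)" "spans (insert y ?R \<inter> ?E)" for y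
      using that A1 A2 cR finA unfolding bN by auto
    show "\<exists>y\<in>A2 - A1. insert y ?R \<in> bases N"
    proof (cases "spans (?R \<inter> ?E)")
      \<comment> \<open>Removing \<open>x\<close> destroys spanning in \<open>M'\<close>. Some
        \<open>y\<close> from \<open>A2\<close> raises the rank in \<open>M'\<close> again; by the
        quotient inequality it raises the rank in \<open>M\<close> too, so independence
        survives.\<close>
      case False
      then have lt: "rk M' (?R \<inter> ?E) < rk M' (A2 \<inter> ?E)"
        using A2 rk_mono[OF M', of "?R \<inter> ?E" ?E] unfolding bN spans_def by simp
      obtain I where I: "I \<subseteq> ?R \<inter> ?E" "indep M' I" "card I = rk M' (?R \<inter> ?E)" using rk_attained[OF M'] .
      obtain J where J: "J \<subseteq> A2 \<inter> ?E" "indep M' J" "card J = rk M' (A2 \<inter> ?E)" using rk_attained[OF M'] .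
      obtain y where y: "y \<in> J" "y \<notin> I" "indep M' (insert y I)"
        using indep_augment[OF M' I(2) J(2)] lt I(3) J(3) by metis
      have yE: "y \<in> ?E" "y \<in> A2" using y J by blast+
      then have ins: "insert y ?R \<inter> ?E = insert y (?R \<inter> ?E)" by blast
      have "card (insert y I) \<le> rk M' (insert y (?R \<inter> ?E))"
        using card_le_rk[OF M' y(3)] I(1) by blast
      then have ge: "Suc (rk M' (?R \<inter> ?E)) \<le> rk M' (insert y (?R \<inter> ?E))"
        using y(2) I(3) indep_finite[OF M' I(2)] by simp
      then have "y \<notin> ?R" using yE by (metis IntI insert_absorb not_less_eq_eq order_refl)
      then have yA: "y \<notin> A1" using x yE by blast
      have "rk M' ?E \<le> Suc (rk M' (?R \<inter> ?E))"
      proof -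
        have "rk M' (A1 \<inter> ?E) \<le> rk M' (insert x (?R \<inter> ?E))" by (intro rk_mono[OF M']) blast
        then show ?thesis using rk_insert_le[OF M', of x "?R \<inter> ?E"] A1 unfolding bN spans_def by simp
      qed
      then have sp: "spans (insert y (?R \<inter> ?E))"
        using ge rk_mono[OF M', of "insert y (?R \<inter> ?E)" ?E] yE unfolding spans_def by simp
      have fR: "finite (?R \<inter> ?E)" using finE by simp
      have "rk M' (insert y (?R \<inter> ?E)) + rk M (?R \<inter> ?E) \<le> rk M (insert y (?R \<inter> ?E)) + rk M' (?R \<inter> ?E)"
        using qrk[of "?R \<inter> ?E" "insert y (?R \<inter> ?E)"] yE by blast
      then have "Suc (card (?R \<inter> ?E)) \<le> rk M (insert y (?R \<inter> ?E))"
        using ge rk_indep[OF M iR] by simp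
      moreover have "card (insert y (?R \<inter> ?E)) = Suc (card (?R \<inter> ?E))" using fR \<open>y \<notin> ?R\<close> by simp
      ultimately have "indep M (insert y (?R \<inter> ?E))" using indep_if_rk[OF M] fR by simp
      then show ?thesis using base[OF yE(2) yA] sp yE(2) yA unfolding ins by blast
    next
      \<comment> \<open>Spanning is not at stake. A new element of \<open>A2\<close> in
        \<open>T\<close> can be added freely; if there is none, \<open>A2\<close> has more elements
        than \<open>A1 - {x}\<close> in the ground set of \<open>M\<close>, and augmentation in
        \<open>M\<close> applies.\<close>
      case True
      show ?thesis
      proof (cases "A2 \<inter> T \<subseteq> A1")
        case False
        then obtain y where y: "y \<in> A2" "y \<in> T" "y \<notin> A1" by blast
        then have "insert y ?R \<inter> ?E = ?R \<inter> ?E" using disj by blast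
        then show ?thesis using base[OF y(1,3)] iR True y(1,3) by auto
      next
        case sub: True
        then have "card (A2 \<inter> T) \<le> card (?R \<inter> T)" using x T(1) by (intro card_mono) auto
        moreover have "card ?R = card (?R \<inter> ?E) + card (?R \<inter> T)" using A1 bN by (intro split) blast
        moreover have "card A2 = card (A2 \<inter> ?E) + card (A2 \<inter> T)" using A2 bN by (intro split) blast
        ultimately have "card (?R \<inter> ?E) < card (A2 \<inter> ?E)" using cR A2 bN by simp
        then obtain y where y: "y \<in> A2 \<inter> ?E" "y \<notin> ?R \<inter> ?E" "indep M (insert y (?R \<inter> ?E))"
          using indep_augment[OF M iR, of "A2 \<inter> ?E"] A2 bN by blast
        then have "insert y ?R \<inter> ?E = insert y (?R \<inter> ?E)" by blast
        moreover have "spans (insert y (?R \<inter> ?E))" using spans_mono[OF True] y(1) by blast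
        moreover have "y \<in> A2" "y \<notin> A1" using y x by blast+
        ultimately show ?thesis using base[of y] y(3) by auto
      qed
    qed
  qed
  moreover have "M = delete N T"
  proof (rule basis_system.expand, intro conjI)
    show "ground M = ground (delete N T)" using gN disj by (auto simp: ground_delete)
    obtain B where "B \<in> bases M" using M unfolding matroid_def by blast
    then show "bases M = bases (delete N T)"
      using bases_delete[OF \<open>matroid N\<close>, of B T] base_of_M by blast
  qed
  moreover have "M' = contract N T"
  proof (rule basis_system.expand, intro conjI)
    show "ground M' = ground (contract N T)" using gN disj E' by (auto simp: ground_contract)
    obtain B0 where B0: "B0 \<in> bases M'" using M' unfolding matroid_def by blast
    have "indep N T" using indep_mono[OF base_indep[OF lift_base[OF B0]]] by blast
    then have rkT: "rk N T = card T" by (rule rk_indep[OF \<open>matroid N\<close>])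
    have TN: "T \<subseteq> ground N" using gN by blast
    show "bases M' = bases (contract N T)"
      unfolding bases_contract[OF \<open>matroid N\<close> TN] rkT
    proof (intro equalityI subsetI)
      fix B assume B: "B \<in> bases M'"
      have "B = (B \<union> T) - T" using base_subset_ground[OF M' B] E' disj by blast
      moreover have "card ((B \<union> T) \<inter> T) = card T" by (simp add: Int_absorb1)
      ultimately show "B \<in> {A - T |A. A \<in> bases N \<and> card (A \<inter> T) = card T}"
        using lift_base[OF B] by blast
    next
      fix B assume "B \<in> {A - T |A. A \<in> bases N \<and> card (A \<inter> T) = card T}"
      then obtain A where A: "B = A - T" "A \<in> bases N" "card (A \<inter> T) = card T" by blast
      then have BE: "B = A \<inter> ?E" using bN disj by blast
      have "card A = card (A \<inter> ?E) + card T" using split[of A] A(2,3) bN by simp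
      then have "card B = rk M' ?E" using A(2) T(2) rkle unfolding bN BE by linarith
      moreover have "rk M' B = rk M' ?E" using A(2) unfolding BE bN spans_def by blast
      moreover have "finite B" unfolding BE using finE by simp
      ultimately show "B \<in> bases M'" using indep_if_rk[OF M'] unfolding base_iff[OF M'] E' by simp
    qed
  qed
  ultimately show ?thesis unfolding quotient_of_def using gN disj by blast
qed

section \<open>Lattice path matroids as transversal matroids\<close>

text \<open>The path as a function of the number of steps, so that paths are compared pointwise
  instead of through sorted lists. The range \<open>{..t}\<close> contains 0, hence the side
  conditions \<open>0 \<notin> A\<close>.\<close>

definition ht :: "nat set \<Rightarrow> nat \<Rightarrow> nat" where
  "ht A t = card (A \<inter> {..t})"

lemma ht_mono: "s \<le> t \<Longrightarrow> ht A s \<le> ht A t"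
  unfolding ht_def by (intro card_mono) auto

lemma ht_mono_set: "A \<subseteq> B \<Longrightarrow> ht A t \<le> ht B t"
  unfolding ht_def by (intro card_mono) auto

lemma ht_le_add:
  assumes "s \<le> t"
  shows "ht A t \<le> ht A s + (t - s)"
proof -
  have "A \<inter> {..t} \<subseteq> (A \<inter> {..s}) \<union> {s<..t}" by auto
  then have "card (A \<inter> {..t}) \<le> card ((A \<inter> {..s}) \<union> {s<..t})" by (intro card_mono) auto
  also have "\<dots> \<le> card (A \<inter> {..s}) + card {s<..t}" by (rule card_Un_le)
  finally show ?thesis by (simp add: ht_def)
qed

lemma ht_Suc: "ht A (Suc t) = ht A t + (if Suc t \<in> A then 1 else 0)"
proof -
  have "A \<inter> {..Suc t} = (if Suc t \<in> A then insert (Suc t) (A \<inter> {..t}) else A \<inter> {..t})"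
    by (auto simp: le_Suc_eq)
  then show ?thesis by (simp add: ht_def)
qed

lemma ht_remove:
  assumes "a \<in> A"
  shows "ht A t = ht (A - {a}) t + (if a \<le> t then 1 else 0)"
proof (cases "a \<le> t")
  case True
  then have "A \<inter> {..t} = insert a ((A - {a}) \<inter> {..t})" using assms by auto
  moreover have "a \<notin> (A - {a}) \<inter> {..t}" "finite ((A - {a}) \<inter> {..t})" by auto
  ultimately show ?thesis using True unfolding ht_def by simp
next
  case False
  then have "A \<inter> {..t} = (A - {a}) \<inter> {..t}" by auto
  then show ?thesis using False unfolding ht_def by simp
qed

lemma ht_zero: "0 \<notin> A \<Longrightarrow> ht A 0 = 0"
  by (simp add: ht_def)

lemma ht_eq_card: "A \<subseteq> {..n} \<Longrightarrow> n \<le> t \<Longrightarrow> ht A t = card A"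
  unfolding ht_def by (metis Int_absorb2 atMost_subset_iff subset_trans)

lemma card_Int_interval: "i \<le> j \<Longrightarrow> card (A \<inter> {i<..j}) + ht A i = ht A j"
proof -
  assume "i \<le> j"
  then have "A \<inter> {..j} = (A \<inter> {i<..j}) \<union> (A \<inter> {..i})" by auto
  moreover have "(A \<inter> {i<..j}) \<inter> (A \<inter> {..i}) = {}" by auto
  ultimately show ?thesis unfolding ht_def by (simp add: card_Un_disjoint)
qed

lemma ht_image: "inj_on f S \<Longrightarrow> ht (f ` S) t = card {s \<in> S. f s \<le> t}"
proof -
  assume "inj_on f S"
  then have "inj_on f {s \<in> S. f s \<le> t}" by (rule inj_on_subset) blast
  moreover have "f ` S \<inter> {..t} = f ` {s \<in> S. f s \<le> t}" by auto
  ultimately show ?thesis by (simp add: ht_def card_image)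
qed

lemma ht_image_le:
  assumes "finite S" "inj_on f S" "inj_on g S" "\<And>s. s \<in> S \<Longrightarrow> g s \<le> f s"
  shows "ht (f ` S) t \<le> ht (g ` S) t"
  unfolding ht_image[OF assms(2)] ht_image[OF assms(3)]
  using assms(1,4) by (intro card_mono) (auto intro: le_trans)

lemma ht_strict_mono_image:
  fixes f :: "nat \<Rightarrow> nat"
  assumes "strict_mono_on {..<k} f" "s < k"
  shows "ht (f ` {..<k}) (f s) = Suc s"
proof -
  have "{r \<in> {..<k}. f r \<le> f s} = {..s}"
    using assms by (auto simp: strict_mono_on_leD) (metis assms lessThan_iff linorder_not_le strict_mono_onD)
  then show ?thesis using ht_image[OF strict_mono_on_imp_inj_on[OF assms(1)]] by simp
qed

text \<open>If \<open>f s < g s\<close>, then up to position \<open>f s\<close> the values of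
  \<open>g\<close> come only from arguments before \<open>s\<close>, whereas those of
  \<open>f\<close> include \<open>s\<close> itself. So one comparison of heights, at
  \<open>f s\<close>, suffices.\<close>

lemma le_if_ht_le:
  fixes f g :: "nat \<Rightarrow> nat"
  assumes S: "finite S" and f: "strict_mono_on S f" and g: "strict_mono_on S g"
    and le: "ht (f ` S) (f s) \<le> ht (g ` S) (f s)" and s: "s \<in> S"
  shows "g s \<le> f s"
proof (rule ccontr)
  assume "\<not> g s \<le> f s"
  then have lt: "f s < g s" by simp
  have "{r \<in> S. g r \<le> f s} \<subseteq> {r \<in> S. r < s}"
  proof
    fix r assume r: "r \<in> {r \<in> S. g r \<le> f s}"
    have "\<not> s \<le> r"
    proof
      assume "s \<le> r"
      then have "g s \<le> g r" using strict_mono_on_leD[OF g s] r by blast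
      then show False using r lt by simp
    qed
    then show "r \<in> {r \<in> S. r < s}" using r by simp
  qed
  also have "\<dots> \<subset> {r \<in> S. f r \<le> f s}"
    using strict_mono_onD[OF f _ s] s by (auto intro: less_imp_le)
  finally have "card {r \<in> S. g r \<le> f s} < card {r \<in> S. f r \<le> f s}"
    using S by (intro psubset_card_mono) auto
  then show False
    using le ht_image[OF strict_mono_on_imp_inj_on[OF f]] ht_image[OF strict_mono_on_imp_inj_on[OF g]]
    by simp
qed

lemma finite_enum:
  fixes A :: "nat set"
  assumes "finite A"
  shows "strict_mono_on {..<card A} ((!) (sorted_list_of_set A))"
    and "(!) (sorted_list_of_set A) ` {..<card A} = A"
proof -
  show "strict_mono_on {..<card A} ((!) (sorted_list_of_set A))"
    using strict_sorted_list_of_set[of A]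
    by (intro strict_mono_onI) (simp add: sorted_wrt_nth_less)
  have "(!) (sorted_list_of_set A) ` {..<length (sorted_list_of_set A)} = set (sorted_list_of_set A)"
    by (auto simp: in_set_conv_nth)
  then show "(!) (sorted_list_of_set A) ` {..<card A} = A" using assms by simp
qed

text \<open>Early North steps make a path high, hence the reversed inequality of heights.\<close>

lemma gale_le_iff:
  assumes "finite A" "finite B"
  shows "gale_le A B \<longleftrightarrow> card A = card B \<and> (\<forall>t. ht B t \<le> ht A t)"
proof -
  let ?a = "(!) (sorted_list_of_set A)" and ?b = "(!) (sorted_list_of_set B)"
  note a = finite_enum[OF assms(1)] and b = finite_enum[OF assms(2)]
  have "gale_le A B \<longleftrightarrow> card A = card B \<and> (\<forall>i<card A. ?a i \<le> ?b i)"
    unfolding gale_le_def list_all2_conv_all_nth by simp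
  moreover have "(\<forall>i<card A. ?a i \<le> ?b i) \<longleftrightarrow> (\<forall>t. ht B t \<le> ht A t)" if eq: "card A = card B"
  proof
    assume "\<forall>i<card A. ?a i \<le> ?b i"
    then show "\<forall>t. ht B t \<le> ht A t"
      using ht_image_le[of "{..<card A}" ?b ?a] a b eq strict_mono_on_imp_inj_on by fastforce
  next
    assume "\<forall>t. ht B t \<le> ht A t"
    then show "\<forall>i<card A. ?a i \<le> ?b i"
      using le_if_ht_le[of "{..<card A}" ?b ?a] a b eq by simp
  qed
  ultimately show ?thesis by blast
qed

section \<open>Transversals of interval families\<close>

text \<open>When both ends of the intervals increase, a matching can be taken order preserving, and
  then heights decide. \<open>S\<close> is any finite index set because index sets with one slot
  left out occur later.\<close>

lemma ex_slots_iff_ht: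
  fixes x y :: "nat \<Rightarrow> nat"
  assumes S: "finite S" and x: "strict_mono_on S x" and y: "strict_mono_on S y" and B: "finite B"
  shows "(\<exists>f. inj_on f S \<and> f ` S = B \<and> (\<forall>s\<in>S. f s \<in> {x s..y s})) \<longleftrightarrow>
     card B = card S \<and> (\<forall>t. ht B t \<le> ht (x ` S) t \<and> ht (y ` S) t \<le> ht B t)"
proof
  assume "\<exists>f. inj_on f S \<and> f ` S = B \<and> (\<forall>s\<in>S. f s \<in> {x s..y s})"
  then obtain f where f: "inj_on f S" "B = f ` S" "\<And>s. s \<in> S \<Longrightarrow> x s \<le> f s \<and> f s \<le> y s" by auto
  show "card B = card S \<and> (\<forall>t. ht B t \<le> ht (x ` S) t \<and> ht (y ` S) t \<le> ht B t)"
    using ht_image_le[OF S f(1) strict_mono_on_imp_inj_on[OF x]]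
      ht_image_le[OF S strict_mono_on_imp_inj_on[OF y] f(1)] f card_image[OF f(1)] by simp
next
  assume *: "card B = card S \<and> (\<forall>t. ht B t \<le> ht (x ` S) t \<and> ht (y ` S) t \<le> ht B t)"
  let ?b = "(!) (sorted_list_of_set B)"
  \<comment> \<open>\<open>card (S \<inter> {..<s})\<close> is the position of \<open>s\<close>
    within \<open>S\<close>, so the elements of \<open>B\<close> are assigned in increasing
    order.\<close>
  define f where "f s = ?b (card (S \<inter> {..<s}))" for s
  have lt: "card (S \<inter> {..<s}) < card (S \<inter> {..<r})" if "s \<in> S" "s < r" for s r
    using that S by (intro psubset_card_mono) auto
  have bd: "card (S \<inter> {..<s}) < card S" if "s \<in> S" for s
    using that S by (intro psubset_card_mono) auto
  have f: "strict_mono_on S f"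
  proof (rule strict_mono_onI)
    fix r s assume "r \<in> S" "s \<in> S" "r < s"
    then show "f r < f s"
      using strict_mono_onD[OF finite_enum(1)[OF B]] lt bd * unfolding f_def by simp
  qed
  note fi = strict_mono_on_imp_inj_on[OF f]
  have "f ` S \<subseteq> B" using finite_enum(2)[OF B] bd * unfolding f_def by (auto simp del: length_sorted_list_of_set)
  then have fB: "f ` S = B" using card_subset_eq[OF B] card_image[OF fi] * by simp
  have "f s \<in> {x s..y s}" if "s \<in> S" for s
    using le_if_ht_le[OF S f x _ that] le_if_ht_le[OF S y f _ that] * fB by simp
  then show "\<exists>f. inj_on f S \<and> f ` S = B \<and> (\<forall>s\<in>S. f s \<in> {x s..y s})" using fi fB by blast
qed

definition transversal_system :: "'a set \<Rightarrow> 'i set \<Rightarrow> ('i \<Rightarrow> 'a set) \<Rightarrow> 'a basis_system" where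
  "transversal_system G S A = Basis_System G {f ` S |f. inj_on f S \<and> (\<forall>s\<in>S. f s \<in> A s)}"

lemma inj_on_fun_upd_Diff:
  assumes "inj_on f (S - {r})" "v \<notin> f ` (S - {r})"
  shows "inj_on (f(r := v)) S"
proof (rule inj_onI)
  fix s t assume "s \<in> S" "t \<in> S" "(f(r := v)) s = (f(r := v)) t"
  then show "s = t" using inj_onD[OF assms(1), of s t] assms(2) by (cases "s = r"; cases "t = r") force+
qed

text \<open>An alternating path, written as a recursion: the slot \<open>r\<close> of
  \<open>x\<close> receives \<open>g r\<close> instead. If \<open>f\<close> uses \<open>g r\<close>
  in another slot, that occurrence must be exchanged in turn, among the slots other than
  \<open>r\<close>.\<close>

lemma transversal_exchange:
  assumes "finite S" "inj_on f S" "\<forall>s\<in>S. f s \<in> A s" "inj_on g S" "\<forall>s\<in>S. g s \<in> A s"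
    and "x \<in> f ` S" "x \<notin> g ` S"
  shows "\<exists>y h. y \<in> g ` S \<and> y \<notin> f ` S \<and> inj_on h S \<and> (\<forall>s\<in>S. h s \<in> A s) \<and> h ` S = insert y (f ` S - {x})"
  using assms
proof (induction "card S" arbitrary: S x)
  case 0
  then show ?case by auto
next
  case (Suc k)
  obtain r where r: "r \<in> S" "x = f r" using Suc.prems(6) by blast
  let ?S = "S - {r}"
  have fS: "f ` ?S = f ` S - {x}" using Suc.prems(2) r by (auto simp: inj_on_def)
  have gS: "g ` ?S = g ` S - {g r}" using Suc.prems(4) r by (auto simp: inj_on_def)
  have inj: "inj_on f ?S" "inj_on g ?S" using Suc.prems(2,4) by (auto intro: inj_on_subset)
  have ext: "inj_on (h(r := g r)) S \<and> (\<forall>s\<in>S. (h(r := g r)) s \<in> A s) \<and> (h(r := g r)) ` S = insert (g r) (h ` ?S)"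
    if "inj_on h ?S" "\<forall>s\<in>?S. h s \<in> A s" "g r \<notin> h ` ?S" for h
  proof (intro conjI ballI)
    show "inj_on (h(r := g r)) S" using that(1,3) by (rule inj_on_fun_upd_Diff)
    show "(h(r := g r)) s \<in> A s" if "s \<in> S" for s
      using that \<open>\<forall>s\<in>?S. h s \<in> A s\<close> Suc.prems(5) by (cases "s = r") simp_all
    show "(h(r := g r)) ` S = insert (g r) (h ` ?S)"
      using r(1) by auto
  qed
  show ?case
  proof (cases "g r \<in> f ` S")
    case False
    then have "g r \<notin> f ` ?S" by blast
    then show ?thesis using ext[OF inj(1)] Suc.prems(3) False r(1) unfolding fS by blast
  next
    case True
    have ne: "g r \<noteq> x" using Suc.prems(7) r(1) by blast
    have "k = card ?S" using Suc.hyps(2) Suc.prems(1) r(1) by simp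
    moreover have "g r \<in> f ` ?S" "g r \<notin> g ` ?S" using True ne unfolding fS gS by blast+
    ultimately obtain y h where h: "y \<in> g ` ?S" "y \<notin> f ` ?S" "inj_on h ?S" "\<forall>s\<in>?S. h s \<in> A s"
      "h ` ?S = insert y (f ` ?S - {g r})"
      using Suc.hyps(1)[of ?S "g r"] Suc.prems(1,3,5) inj by auto
    have yx: "y \<noteq> x" using h(1) Suc.prems(7) by blast
    have "g r \<notin> h ` ?S" using h(1,5) gS by blast
    moreover have "insert (g r) (h ` ?S) = insert y (f ` S - {x})"
      using \<open>g r \<in> f ` ?S\<close> unfolding h(5) fS by blast
    moreover have "y \<in> g ` S" "y \<notin> f ` S" using h(1,2) fS yx by blast+
    ultimately show ?thesis using ext[OF h(3,4)] by metis
  qed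
qed

lemma matroid_transversal:
  assumes "finite G" "finite S" "\<And>s. s \<in> S \<Longrightarrow> A s \<subseteq> G" "inj_on f\<^sub>0 S" "\<And>s. s \<in> S \<Longrightarrow> f\<^sub>0 s \<in> A s"
  shows "matroid (transversal_system G S A)"
  unfolding matroid_def
proof (intro conjI ballI)
  let ?N = "transversal_system G S A"
  show "finite (ground ?N)" using assms(1) by (simp add: transversal_system_def)
  show "bases ?N \<noteq> {}" using assms(4,5) by (auto simp: transversal_system_def)
  show "B \<subseteq> ground ?N" if "B \<in> bases ?N" for B
    using that assms(3) by (auto simp: transversal_system_def)
  fix B C x assume "B \<in> bases ?N" "C \<in> bases ?N" "x \<in> B - C"
  then obtain f g where fg: "inj_on f S" "\<forall>s\<in>S. f s \<in> A s" "inj_on g S" "\<forall>s\<in>S. g s \<in> A s"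
    "B = f ` S" "C = g ` S" "x \<in> f ` S" "x \<notin> g ` S"
    unfolding transversal_system_def by auto
  obtain y h where "y \<in> C" "y \<notin> B" "inj_on h S" "\<forall>s\<in>S. h s \<in> A s" "insert y (B - {x}) = h ` S"
    using transversal_exchange[OF assms(2) fg(1-4,7,8)] unfolding fg(5,6)[symmetric] by metis
  moreover from this(3-5) have "insert y (B - {x}) \<in> bases ?N"
    unfolding transversal_system_def by auto
  ultimately show "\<exists>y\<in>C - B. insert y (B - {x}) \<in> bases ?N" by blast
qed

section \<open>Lattice path matroids\<close>

lemma path_pair_finite: "path_pair n U L \<Longrightarrow> finite U \<and> finite L"
  unfolding path_pair_def by (meson finite_atLeastAtMost finite_subset)

lemma path_pair_iff:
  "path_pair n U L \<longleftrightarrow> U \<subseteq> {1..n} \<and> L \<subseteq> {1..n} \<and> card U = card L \<and> (\<forall>t. ht L t \<le> ht U t)"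
  unfolding path_pair_def using gale_le_iff[of U L] by (meson finite_atLeastAtMost finite_subset)

lemma bases_lpm_iff:
  assumes "path_pair n U L"
  shows "B \<in> bases (lpm n U L) \<longleftrightarrow>
    B \<subseteq> {1..n} \<and> card B = card U \<and> (\<forall>t. ht B t \<le> ht U t \<and> ht L t \<le> ht B t)"
proof -
  have "finite B" if "B \<subseteq> {1..n}" using that finite_subset by blast
  then show ?thesis
    using assms path_pair_finite[OF assms] gale_le_iff[of U B] gale_le_iff[of B L]
    unfolding path_pair_iff lpm_def by auto
qed

lemma path_pair_enum:
  assumes "path_pair n U L"
  obtains x y where "strict_mono_on {..<card U} x" "strict_mono_on {..<card U} y"
    "x ` {..<card U} = U" "y ` {..<card U} = L" "\<And>s. s < card U \<Longrightarrow> x s \<le> y s"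
proof -
  note fin = path_pair_finite[OF assms]
  have eq: "card L = card U" using assms by (simp add: path_pair_iff)
  note x = finite_enum[of U] and y = finite_enum[of L]
  have "(!) (sorted_list_of_set U) s \<le> (!) (sorted_list_of_set L) s" if "s < card U" for s
    using le_if_ht_le[of "{..<card U}" _ "(!) (sorted_list_of_set U)" s] x y fin eq that assms
    by (simp add: path_pair_iff)
  then show ?thesis using that x y fin eq by metis
qed

lemma bases_lpm_transversal:
  assumes "path_pair n U L" and k: "k = card U"
    and x: "strict_mono_on {..<k} x" "x ` {..<k} = U" and y: "strict_mono_on {..<k} y" "y ` {..<k} = L"
  shows "B \<in> bases (lpm n U L) \<longleftrightarrow> (\<exists>f. inj_on f {..<k} \<and> f ` {..<k} = B \<and> (\<forall>s\<in>{..<k}. f s \<in> {x s..y s}))"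
    (is "_ \<longleftrightarrow> ?R")
proof
  assume "B \<in> bases (lpm n U L)"
  moreover then have "finite B" using finite_subset unfolding bases_lpm_iff[OF assms(1)] by blast
  ultimately show ?R
    using ex_slots_iff_ht[OF _ x(1) y(1), of B] k x(2) y(2) unfolding bases_lpm_iff[OF assms(1)] by simp
next
  assume R: ?R
  then have fin: "finite B" by auto
  obtain f where f: "f ` {..<k} = B" "\<forall>s\<in>{..<k}. f s \<in> {x s..y s}" using R by blast
  have "B \<subseteq> {1..n}"
  proof
    fix b assume "b \<in> B"
    then obtain s where s: "s < k" "b = f s" using f(1) by auto
    then have "x s \<in> U" "y s \<in> L" using x(2) y(2) by auto
    then have "1 \<le> x s" "y s \<le> n" using assms(1) unfolding path_pair_def by auto
    moreover have "x s \<le> f s" "f s \<le> y s" using s(1) f(2) by simp_all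
    ultimately show "b \<in> {1..n}" using s(2) by simp
  qed
  then show "B \<in> bases (lpm n U L)"
    using R ex_slots_iff_ht[OF _ x(1) y(1) fin] k x(2) y(2) unfolding bases_lpm_iff[OF assms(1)] by simp
qed

lemma ground_lpm: "ground (lpm n U L) = {1..n}"
  by (simp add: lpm_def)

lemma matroid_lpm:
  assumes "path_pair n U L"
  shows "matroid (lpm n U L)"
proof -
  obtain x y where e: "strict_mono_on {..<card U} x" "strict_mono_on {..<card U} y"
    "x ` {..<card U} = U" "y ` {..<card U} = L" "\<And>s. s < card U \<Longrightarrow> x s \<le> y s"
    using path_pair_enum[OF assms] by blast
  have "1 \<le> x s" "y s \<le> n" if "s < card U" for s
  proof -
    have "x s \<in> U" "y s \<in> L" using that e(3,4) by auto
    then show "1 \<le> x s" "y s \<le> n" using assms unfolding path_pair_def by auto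
  qed
  then have "{x s..y s} \<subseteq> {1..n}" if "s \<in> {..<card U}" for s
    using that by fastforce
  then have "matroid (transversal_system {1..n} {..<card U} (\<lambda>s. {x s..y s}))"
    using e(5) strict_mono_on_imp_inj_on[OF e(1)] by (intro matroid_transversal[of _ _ _ x]) auto
  moreover have "bases (lpm n U L) = {f ` {..<card U} |f. inj_on f {..<card U} \<and> (\<forall>s\<in>{..<card U}. f s \<in> {x s..y s})}"
    unfolding set_eq_iff bases_lpm_transversal[OF assms refl e(1,3,2,4)] by blast
  then have "lpm n U L = transversal_system {1..n} {..<card U} (\<lambda>s. {x s..y s})"
    by (intro basis_system.expand) (simp add: transversal_system_def ground_lpm)
  ultimately show ?thesis by simp
qed

section \<open>Good pairs and ranks of intervals\<close>

text \<open>In the paper's notation \<open>ht U u\<close> is the index \<open>j\<close> of \<open>u = u\<^sub>j\<close> and \<open>ht L l\<close> is the index \<open>i\<close> of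
  \<open>l = \<ell>\<^sub>i\<close>.\<close>

definition good_pair :: "nat set \<Rightarrow> nat set \<Rightarrow> nat \<Rightarrow> nat \<Rightarrow> bool" where
  "good_pair U L l u \<longleftrightarrow> u \<in> U \<and> l \<in> L \<and> ht L l \<le> ht U u \<and> u + ht L l \<le> l + ht U u"

text \<open>The step \<open>m\<close> is the first one of the original lower path at which \<open>B\<close> drops below that path, or \<open>j\<close>
  if this does not happen before \<open>y j\<close>.\<close>

lemma good_pair_common_step:
  fixes x y :: "nat \<Rightarrow> nat"
  assumes x: "strict_mono_on {..<k} x" and y: "strict_mono_on {..<k} y"
    and L0: "0 \<notin> y ` {..<k}" and ij: "i \<le> j" "j < k" "x j + i \<le> y i + j"
    and B: "\<And>t. ht B t \<le> ht (x ` {..<k} - {x j}) t" "\<And>t. ht (y ` {..<k} - {y i}) t \<le> ht B t"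
  obtains m where "i \<le> m" "m \<le> j" "\<And>t. ht B t \<le> ht (x ` {..<k} - {x m}) t"
    "\<And>t. ht (y ` {..<k} - {y m}) t \<le> ht B t"
proof -
  let ?U = "x ` {..<k}" and ?L = "y ` {..<k}"
  have rU: "ht ?U t = ht (?U - {x m}) t + (if x m \<le> t then 1 else 0)" if "m < k" for m t
    using that by (intro ht_remove) simp
  have rL: "ht ?L t = ht (?L - {y m}) t + (if y m \<le> t then 1 else 0)" if "m < k" for m t
    using that by (intro ht_remove) simp
  have lower: "ht (?L - {y m}) t \<le> ht B t"
    if m: "i \<le> m" "m < k" and ok: "\<And>t. t < y m \<Longrightarrow> ht ?L t \<le> ht B t" for m t
  proof (cases "t < y m")
    case True
    then show ?thesis using ok[OF True] rL[OF m(2), of t] by simp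
  next
    case False
    have "y i \<le> y m" using strict_mono_on_leD[OF y] m by simp
    then show ?thesis using False rL[OF m(2), of t] rL[of i t] m B(2)[of t] by simp
  qed
  show ?thesis
  proof (cases "\<forall>t<y j. ht ?L t \<le> ht B t")
    case True
    then show ?thesis using that[of j] ij B(1) lower by simp
  next
    case False
    then obtain t0 where t0: "t0 < y j" "ht B t0 < ht ?L t0" by (meson not_le)
    define p where "p = (LEAST p. ht B p < ht ?L p)"
    have p: "ht B p < ht ?L p" unfolding p_def using t0(2) by (rule LeastI)
    have before: "ht ?L t \<le> ht B t" if "t < p" for t
      using not_less_Least[of t "\<lambda>p. ht B p < ht ?L p"] that unfolding p_def by simp
    have pj: "p < y j" using t0 Least_le[of "\<lambda>p. ht B p < ht ?L p" t0] unfolding p_def by simp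
    have "p \<noteq> 0" using p ht_zero[OF L0] by (intro notI) simp
    then obtain q where q: "p = Suc q" by (cases p) auto
    have "ht ?L q \<le> ht B q" using before q by simp
    moreover have "ht B q \<le> ht B p" by (rule ht_mono) (simp add: q)
    ultimately have pL: "p \<in> ?L" and eq: "Suc (ht B p) = ht ?L p"
      using p ht_Suc[of ?L q] unfolding q by (auto split: if_splits)
    obtain m where m: "m < k" "p = y m" using pL by auto
    \<comment> \<open>\<open>y\<close> is indexed from 0, so the lower path has height
      \<open>m + 1\<close> at its North step \<open>y m\<close>, and \<open>B\<close> is one short
      of it.\<close>
    have Bp: "ht B p = m" using ht_strict_mono_image[OF y m(1)] eq m(2) by simp
    have "y i \<le> p" using rL[of i p] B(2)[of p] p ij by (simp split: if_splits)
    then have im: "i \<le> m" using strict_mono_onD[OF y, of m i] m ij by (meson lessThan_iff linorder_not_le le_less_trans)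
    have mj: "m < j" using pj strict_mono_on_leD[OF y, of j m] m ij by (meson lessThan_iff linorder_not_le)
    have "ht B t \<le> ht (?U - {x m}) t" for t
    \<comment> \<open>Removing \<open>x m\<close> instead of \<open>x j\<close> tightens the bound
      only in this window, where \<open>B\<close> has to be strictly below the upper path.\<close>
    proof (cases "x m \<le> t \<and> t < x j")
      case False
      have "x m < x j" using strict_mono_onD[OF x _ _ mj] m ij by simp
      then show ?thesis using False rU[OF m(1), of t] rU[OF ij(2), of t] B(1)[of t] by (auto split: if_splits)
    next
      case True
      have "Suc (ht B t) \<le> ht ?U t"
      proof (cases "t < p")
        case tp: True
        have "Suc m \<le> ht ?U t"
          using ht_mono[of "x m" t ?U] ht_strict_mono_image[OF x m(1)] True by simp
        then show ?thesis using ht_mono[of t p B] tp Bp by simp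
      next
        case False
        \<comment> \<open>Heights rise by at most one per step. Following \<open>B\<close> from
          height \<open>m\<close> at \<open>y m\<close>, the lower path from \<open>y i\<close> to
          \<open>y m\<close>, and the upper path from \<open>t\<close> to \<open>x j - 1\<close>,
          where its height is \<open>j\<close>, reduces the claim to
          \<open>x j + i \<le> y i + j\<close>.\<close>
        then have "ht B t + y m \<le> m + t" using ht_le_add[of p t B] Bp m(2) by simp
        moreover have "Suc j + t \<le> ht ?U t + x j"
        proof -
          have "\<not> x j \<le> x j - 1" using True by linarith
          have "ht (?U - {x j}) (x j) = ht (?U - {x j}) (x j - 1)"
            using True ht_Suc[of "?U - {x j}" "x j - 1"] by simp
          then have "j = ht ?U (x j - 1)"
            using rU[OF ij(2), of "x j"] rU[OF ij(2), of "x j - 1"] \<open>\<not> x j \<le> x j - 1\<close>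
              ht_strict_mono_image[OF x ij(2)] by simp
          moreover have "t \<le> x j - 1" "t < x j" using True by linarith+
          ultimately show ?thesis using ht_le_add[of t "x j - 1" ?U] by linarith
        qed
        moreover have "y i + m \<le> y m + i"
          using ht_le_add[of "y i" "y m" ?L] ht_strict_mono_image[OF y] m \<open>y i \<le> p\<close> ij by simp
        ultimately show ?thesis using ij(3) by linarith
      qed
      then show ?thesis using rU[OF m(1), of t] True by simp
    qed
    then show ?thesis using that[of m] im mj m lower[OF im m(1)] before by simp
  qed
qed

text \<open>A base of the lift through \<open>n + 1\<close> spends one slot between \<open>i\<close>
  and \<open>j\<close> on it. That every base of the smaller matroid arises in this way is what
  \<open>good_pair_common_step\<close> provides.\<close>

lemma good_pair_rank_quotient:
  assumes pp: "path_pair n U L" and pp': "path_pair n (U - {u}) (L - {l})" and good: "good_pair U L l u"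
  shows "rank_quotient (lpm n (U - {u}) (L - {l})) (lpm n U L)"
proof -
  define k where "k = card U"
  obtain x y where x: "strict_mono_on {..<k} x" "x ` {..<k} = U" and y: "strict_mono_on {..<k} y" "y ` {..<k} = L"
    and xy: "\<And>s. s < k \<Longrightarrow> x s \<le> y s"
    using path_pair_enum[OF pp] unfolding k_def by metis
  have bnd: "1 \<le> x s" "y s \<le> n" if "s < k" for s
  proof -
    have "x s \<in> U" "y s \<in> L" using that x(2) y(2) by auto
    then show "1 \<le> x s" "y s \<le> n" using pp unfolding path_pair_def by auto
  qed
  obtain i j where i: "i < k" "l = y i" and j: "j < k" "u = x j"
    using good x(2) y(2) unfolding good_pair_def by auto
  have ij: "i \<le> j" "x j + i \<le> y i + j"
    using good ht_strict_mono_image[OF x(1) j(1)] ht_strict_mono_image[OF y(1) i(1)] x(2) y(2) i j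
    unfolding good_pair_def by simp_all
  note inj = strict_mono_on_imp_inj_on[OF x(1)] strict_mono_on_imp_inj_on[OF y(1)]
  \<comment> \<open>The elementary lift is again transversal: let \<open>n + 1\<close> also represent the intervals \<open>i\<close> to \<open>j\<close>.\<close>
  define A where "A s = {x s..y s} \<union> (if i \<le> s \<and> s \<le> j then {Suc n} else {})" for s
  define N where "N = transversal_system {1..Suc n} {..<k} A"
  have N: "matroid N"
    unfolding N_def
  proof (rule matroid_transversal[of _ _ _ x])
    show "A s \<subseteq> {1..Suc n}" if "s \<in> {..<k}" for s
      using bnd[of s] that unfolding A_def by auto
    show "x s \<in> A s" if "s \<in> {..<k}" for s using xy that unfolding A_def by simp
  qed (use inj in auto)
  have gN: "ground N = {1..Suc n}" by (simp add: N_def transversal_system_def)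
  have bN: "C \<in> bases N \<longleftrightarrow> (\<exists>f. inj_on f {..<k} \<and> f ` {..<k} = C \<and> (\<forall>s\<in>{..<k}. f s \<in> A s))" for C
    unfolding N_def transversal_system_def by auto
  have Suc_n: "Suc n \<notin> {x s..y s}" if "s < k" for s using bnd(2)[OF that] by simp
  have avoid: "C \<in> bases N \<and> Suc n \<notin> C \<longleftrightarrow> C \<in> bases (lpm n U L)" for C
    unfolding bases_lpm_transversal[OF pp k_def x y] bN
  proof
    assume "(\<exists>f. inj_on f {..<k} \<and> f ` {..<k} = C \<and> (\<forall>s\<in>{..<k}. f s \<in> A s)) \<and> Suc n \<notin> C"
    then obtain f where f: "inj_on f {..<k}" "f ` {..<k} = C" "\<forall>s\<in>{..<k}. f s \<in> A s" "Suc n \<notin> C" by blast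
    have "f s \<in> {x s..y s}" if "s \<in> {..<k}" for s
    proof -
      have "f s \<in> C" using f(2) that by blast
      then have "f s \<noteq> Suc n" using f(4) by metis
      then show ?thesis using f(3) that unfolding A_def by (auto split: if_splits)
    qed
    then show "\<exists>f. inj_on f {..<k} \<and> f ` {..<k} = C \<and> (\<forall>s\<in>{..<k}. f s \<in> {x s..y s})" using f by blast
  next
    assume "\<exists>f. inj_on f {..<k} \<and> f ` {..<k} = C \<and> (\<forall>s\<in>{..<k}. f s \<in> {x s..y s})"
    then obtain f where f: "inj_on f {..<k}" "f ` {..<k} = C" "\<forall>s\<in>{..<k}. f s \<in> {x s..y s}" by blast
    then have "Suc n \<notin> C" using Suc_n by (metis imageE lessThan_iff)
    moreover have "\<forall>s\<in>{..<k}. f s \<in> A s" using f(3) unfolding A_def by blast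
    ultimately show "(\<exists>f. inj_on f {..<k} \<and> f ` {..<k} = C \<and> (\<forall>s\<in>{..<k}. f s \<in> A s)) \<and> Suc n \<notin> C"
      using f by blast
  qed
  have slots: "(\<exists>f. inj_on f ({..<k} - {m}) \<and> f ` ({..<k} - {m}) = C \<and> (\<forall>s\<in>{..<k} - {m}. f s \<in> {x s..y s})) \<longleftrightarrow>
      card C = k - 1 \<and> (\<forall>t. ht C t \<le> ht (U - {x m}) t \<and> ht (L - {y m}) t \<le> ht C t)"
    if m: "m < k" and C: "finite C" for m C
  proof -
    have "x ` ({..<k} - {m}) = U - {x m}" "y ` ({..<k} - {m}) = L - {y m}"
      using inj m x(2) y(2) by (simp_all add: inj_on_image_set_diff[of _ "{..<k}"])
    moreover have "strict_mono_on ({..<k} - {m}) x" "strict_mono_on ({..<k} - {m}) y"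
      using x(1) y(1) unfolding strict_mono_on_def by blast+
    ultimately show ?thesis using ex_slots_iff_ht[of "{..<k} - {m}" x y C] m C by simp
  qed
  have cU: "card (U - {u}) = k - 1" using good unfolding k_def good_pair_def by (simp add: card_Diff_singleton)
  have rU: "ht U t = ht (U - {x m}) t + (if x m \<le> t then 1 else 0)" if "m < k" for m t
    using that x(2) by (intro ht_remove) auto
  have rL: "ht L t = ht (L - {y m}) t + (if y m \<le> t then 1 else 0)" if "m < k" for m t
    using that y(2) by (intro ht_remove) auto
  have lift: "insert (Suc n) C \<in> bases N" if C: "C \<in> bases (lpm n (U - {u}) (L - {l}))" for C
  proof -
    have C': "C \<subseteq> {1..n}" "card C = k - 1"
      "\<And>t. ht C t \<le> ht (U - {u}) t" "\<And>t. ht (L - {l}) t \<le> ht C t"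
      using C cU unfolding bases_lpm_iff[OF pp'] by simp_all
    have "0 \<notin> L" using pp unfolding path_pair_def by auto
    then obtain m where m: "i \<le> m" "m \<le> j" "\<And>t. ht C t \<le> ht (U - {x m}) t" "\<And>t. ht (L - {y m}) t \<le> ht C t"
      using good_pair_common_step[OF x(1) y(1) _ ij(1) j(1) ij(2), of C] C'(3,4) x(2) y(2) i j by metis
    have mk: "m < k" using m j by simp
    have "finite C" using C'(1) finite_subset by blast
    then obtain f where f: "inj_on f ({..<k} - {m})" "f ` ({..<k} - {m}) = C" "\<forall>s\<in>{..<k} - {m}. f s \<in> {x s..y s}"
      using slots[OF mk] C'(2) m(3,4) by metis
    have "Suc n \<notin> C" using C'(1) by auto
    then have "inj_on (f(m := Suc n)) {..<k}"
      using f(1,2) by (intro inj_on_fun_upd_Diff) simp_all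
    moreover have "(f(m := Suc n)) ` {..<k} = insert (Suc n) C" using f(2) mk by auto
    moreover have "\<forall>s\<in>{..<k}. (f(m := Suc n)) s \<in> A s" using f(3) m(1,2) unfolding A_def by simp
    ultimately show ?thesis unfolding bN by blast
  qed
  \<comment> \<open>Since \<open>x m \<le> x j\<close> and \<open>y i \<le> y m\<close>, the bounds
    with index \<open>m\<close> removed imply those with \<open>x j\<close> removed above and
    \<open>y i\<close> removed below.\<close>
  have proj: "C - {Suc n} \<in> bases (lpm n (U - {u}) (L - {l}))" if C: "C \<in> bases N" "Suc n \<in> C" for C
  proof -
    obtain f where f: "inj_on f {..<k}" "f ` {..<k} = C" "\<forall>s\<in>{..<k}. f s \<in> A s"
      using C(1) unfolding bN by blast
    obtain m where m: "m < k" "f m = Suc n" using C(2) f(2) by auto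
    have mij: "i \<le> m" "m \<le> j" using f(3) m Suc_n[OF m(1)] unfolding A_def by (auto split: if_splits)
    have im: "f ` ({..<k} - {m}) = C - {Suc n}"
      using f(1,2) m by (simp add: inj_on_image_set_diff[of _ "{..<k}"])
    have "f s \<in> {x s..y s}" if "s \<in> {..<k} - {m}" for s
    proof -
      have "f s \<noteq> Suc n" using inj_onD[OF f(1), of s m] m that by auto
      then show ?thesis using f(3) that unfolding A_def by (auto split: if_splits)
    qed
    moreover have "inj_on f ({..<k} - {m})" using f(1) by (rule inj_on_subset) blast
    moreover have fin: "finite (C - {Suc n})" using f(2) by auto
    ultimately have *: "card (C - {Suc n}) = k - 1"
      "\<And>t. ht (C - {Suc n}) t \<le> ht (U - {x m}) t" "\<And>t. ht (L - {y m}) t \<le> ht (C - {Suc n}) t"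
      using slots[OF m(1) fin] im by blast+
    have "x m \<le> x j" using strict_mono_on_leD[OF x(1)] mij j by simp
    then have "ht (C - {Suc n}) t \<le> ht (U - {u}) t" for t
      using *(2)[of t] rU[OF m(1), of t] rU[OF j(1), of t] j(2) by (auto split: if_splits)
    moreover have "y i \<le> y m" using strict_mono_on_leD[OF y(1)] mij m i by simp
    then have "ht (L - {l}) t \<le> ht (C - {Suc n}) t" for t
      using *(3)[of t] rL[OF m(1), of t] rL[OF i(1), of t] i(2) by (auto split: if_splits)
    moreover have "C - {Suc n} \<subseteq> {1..n}"
      using base_subset_ground[OF N C(1)] unfolding gN by (auto simp: le_Suc_eq)
    ultimately show ?thesis using *(1) cU unfolding bases_lpm_iff[OF pp'] by simp
  qed
  note M = matroid_lpm[OF pp] and M' = matroid_lpm[OF pp']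
  have "lpm n U L = delete N {Suc n}"
  proof (rule basis_system.expand, intro conjI)
    show "ground (lpm n U L) = ground (delete N {Suc n})" unfolding ground_delete gN ground_lpm by auto
    obtain B where "B \<in> bases (lpm n U L)" using M unfolding matroid_def by blast
    then show "bases (lpm n U L) = bases (delete N {Suc n})"
      using bases_delete[OF N, of B "{Suc n}"] avoid by auto
  qed
  moreover have "lpm n (U - {u}) (L - {l}) = contract N {Suc n}"
  proof (rule basis_system.expand, intro conjI)
    show "ground (lpm n (U - {u}) (L - {l})) = ground (contract N {Suc n})"
      unfolding ground_contract gN ground_lpm by auto
    obtain B where "B \<in> bases (lpm n (U - {u}) (L - {l}))" using M' unfolding matroid_def by blast
    then have "indep N {Suc n}" using indep_mono[OF base_indep[OF lift]] by blast
    then have rk1: "rk N {Suc n} = 1" using rk_indep[OF N] by simp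
    have sub: "{Suc n} \<subseteq> ground N" by (simp add: gN)
    have inS: "card (C \<inter> {Suc n}) = 1 \<longleftrightarrow> Suc n \<in> C" for C by (cases "Suc n \<in> C") auto
    show "bases (lpm n (U - {u}) (L - {l})) = bases (contract N {Suc n})"
      unfolding bases_contract[OF N sub] rk1 inS
    proof (intro equalityI subsetI)
      fix C assume C: "C \<in> bases (lpm n (U - {u}) (L - {l}))"
      then have "Suc n \<notin> C" using base_subset_ground[OF M'] ground_lpm by fastforce
      then have "C = insert (Suc n) C - {Suc n}" by blast
      then show "C \<in> {B - {Suc n} |B. B \<in> bases N \<and> Suc n \<in> B}" using lift[OF C] by blast
    qed (use proj in blast)
  qed
  moreover have "ground (lpm n U L) \<inter> {Suc n} = {}" "ground N = ground (lpm n U L) \<union> {Suc n}"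
    unfolding gN ground_lpm by auto
  ultimately have "lpm n (U - {u}) (L - {l}) \<le>\<^sub>q lpm n U L"
    unfolding quotient_of_def using N by blast
  then show ?thesis using quotient_imp_rank_quotient M' by blast
qed

section \<open>Ranks of intervals and of their complements\<close>

lemma card_base_Int_le_rk: "matroid N \<Longrightarrow> B \<in> bases N \<Longrightarrow> card (B \<inter> X) \<le> rk N X"
  by (rule card_le_rk) (auto intro: indep_mono[OF base_indep])

lemma rk_le_if_bases:
  assumes "matroid N" "\<And>B. B \<in> bases N \<Longrightarrow> card (B \<inter> X) \<le> m"
  shows "rk N X \<le> m"
  unfolding rk_le_iff[OF assms(1)]
proof (intro allI impI)
  fix I assume I: "I \<subseteq> X \<and> indep N I"
  then obtain B where B: "B \<in> bases N" "I \<subseteq> B" unfolding indep_def by blast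
  have "card I \<le> card (B \<inter> X)" using I B base_finite[OF assms(1) B(1)] by (intro card_mono) auto
  then show "card I \<le> m" using assms(2)[OF B(1)] by simp
qed

lemma ht_path_pair_end: "path_pair n U L \<Longrightarrow> n \<le> t \<Longrightarrow> ht U t = card U \<and> ht L t = card U"
proof -
  assume "path_pair n U L" and t: "n \<le> t"
  then have "U \<subseteq> {..n}" "L \<subseteq> {..n}" "card L = card U" unfolding path_pair_iff by auto
  then show ?thesis using ht_eq_card[of _ n t] t by metis
qed

text \<open>Allows a base to be given by drawing a path between the bounding paths. These meet at
  \<open>n\<close>, which fixes the cardinality of \<open>B\<close>.\<close>

lemma base_of_heights:
  assumes pp: "path_pair n U L" and h: "h 0 = 0"
    "\<And>t. t < n \<Longrightarrow> h t \<le> h (Suc t) \<and> h (Suc t) \<le> Suc (h t)"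
    "\<And>t. t \<le> n \<Longrightarrow> ht L t \<le> h t \<and> h t \<le> ht U t"
  obtains B where "B \<in> bases (lpm n U L)" "\<And>t. t \<le> n \<Longrightarrow> ht B t = h t"
proof -
  define B where "B = {t \<in> {1..n}. h t \<noteq> h (t - 1)}"
  have eq: "ht B t = h t" if "t \<le> n" for t
    using that
  proof (induction t)
    case 0
    have "0 \<notin> B" by (simp add: B_def)
    then show ?case using h(1) ht_zero by simp
  next
    case (Suc t)
    then show ?case using h(2)[of t] by (auto simp: ht_Suc B_def)
  qed
  have last: "ht B t = card B" if "n \<le> t" for t using ht_eq_card[of B n t] that by (auto simp: B_def)
  have "card B = card U" using last[of n] eq[of n] h(3)[of n] ht_path_pair_end[OF pp, of n] by simp
  moreover have "ht B t \<le> ht U t \<and> ht L t \<le> ht B t" for t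
  proof (cases "t \<le> n")
    case True
    then show ?thesis using eq h(3) by simp
  next
    case False
    then show ?thesis using last[of t] \<open>card B = card U\<close> ht_path_pair_end[OF pp, of t] by simp
  qed
  ultimately have "B \<in> bases (lpm n U L)" unfolding bases_lpm_iff[OF pp] by (auto simp: B_def)
  then show ?thesis using that eq by blast
qed

lemma lower_path_base: "path_pair n U L \<Longrightarrow> L \<in> bases (lpm n U L)"
  by (simp add: bases_lpm_iff) (simp add: path_pair_iff)

lemma upper_path_base: "path_pair n U L \<Longrightarrow> U \<in> bases (lpm n U L)"
  by (simp add: bases_lpm_iff) (simp add: path_pair_iff)

lemma rk_lpm_initial:
  assumes pp: "path_pair n U L" and "t \<le> n"
  shows "rk (lpm n U L) {0<..t} = ht U t"
proof -
  have c: "card (B \<inter> {0<..t}) = ht B t" if "B \<subseteq> {1..n}" for B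
    using card_Int_interval[of 0 t B] ht_zero[of B] that by fastforce
  have "rk (lpm n U L) {0<..t} \<le> ht U t"
    using c by (intro rk_le_if_bases[OF matroid_lpm[OF pp]]) (simp add: bases_lpm_iff[OF pp])
  moreover have "U \<subseteq> {1..n}" using pp by (simp add: path_pair_def)
  ultimately show ?thesis
    using card_base_Int_le_rk[OF matroid_lpm[OF pp] upper_path_base[OF pp], of "{0<..t}"] c[of U] by simp
qed

lemma rk_lpm_final:
  assumes pp: "path_pair n U L" and t: "t \<le> n"
  shows "rk (lpm n U L) {t<..n} + ht L t = card U"
proof -
  have c: "card (B \<inter> {t<..n}) + ht B t = card U" if "B \<in> bases (lpm n U L)" for B
  proof -
    have "B \<subseteq> {..n}" "card B = card U" using that unfolding bases_lpm_iff[OF pp] by auto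
    then show ?thesis using card_Int_interval[OF t, of B] ht_eq_card[of B n n] by simp
  qed
  have le: "ht L t \<le> card U" using ht_path_pair_end[OF pp, of n] ht_mono[OF t, of L] by simp
  have "rk (lpm n U L) {t<..n} \<le> card U - ht L t"
  proof (rule rk_le_if_bases[OF matroid_lpm[OF pp]])
    fix B assume B: "B \<in> bases (lpm n U L)"
    then have "ht L t \<le> ht B t" by (simp add: bases_lpm_iff[OF pp])
    then show "card (B \<inter> {t<..n}) \<le> card U - ht L t" using c[OF B] by simp
  qed
  then show ?thesis
    using card_base_Int_le_rk[OF matroid_lpm[OF pp] lower_path_base[OF pp], of "{t<..n}"]
      c[OF lower_path_base[OF pp]] le by simp
qed

lemma rk_lpm_interval_le:
  assumes pp: "path_pair n U L" and ij: "i \<le> j"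
  shows "rk (lpm n U L) {i<..j} + ht L i \<le> ht U j"
proof -
  have le: "ht L i \<le> ht U j" using pp ht_mono[OF ij, of U] unfolding path_pair_iff by (meson le_trans)
  have "rk (lpm n U L) {i<..j} \<le> ht U j - ht L i"
  proof (rule rk_le_if_bases[OF matroid_lpm[OF pp]])
    fix B assume B: "B \<in> bases (lpm n U L)"
    then have "ht L i \<le> ht B i" "ht B j \<le> ht U j" by (simp_all add: bases_lpm_iff[OF pp])
    then show "card (B \<inter> {i<..j}) \<le> ht U j - ht L i" using card_Int_interval[OF ij, of B] by linarith
  qed
  then show ?thesis using le by simp
qed

text \<open>The witness follows the lower path up to \<open>i\<close>, then goes North at every step
  until the upper path stops it, collecting as much of the interval as possible.\<close>

lemma rk_lpm_interval_ge:
  assumes pp: "path_pair n U L" and ij: "i \<le> j" "j \<le> n"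
  shows "min (ht U j) (ht L i + (j - i)) \<le> rk (lpm n U L) {i<..j} + ht L i"
proof -
  define h where "h t = (if t \<le> i then ht L t else min (ht U t) (ht L i + (t - i)))" for t
  have LU: "ht L t \<le> ht U t" for t using pp by (simp add: path_pair_iff)
  have "0 \<notin> L" using pp by (auto simp: path_pair_def)
  then have "h 0 = 0" by (simp add: h_def ht_zero)
  moreover have "h t \<le> h (Suc t) \<and> h (Suc t) \<le> Suc (h t)" for t
    using LU[of i] ht_Suc[of U t] ht_Suc[of L t] ht_le_add[of t "Suc t" U] LU[of t] LU[of "Suc t"]
    by (cases "t < i"; cases "t = i") (auto simp: h_def)
  moreover have "ht L t \<le> h t \<and> h t \<le> ht U t" for t
    using LU[of t] ht_le_add[of i t L] by (auto simp: h_def)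
  ultimately obtain B where B: "B \<in> bases (lpm n U L)" "\<And>t. t \<le> n \<Longrightarrow> ht B t = h t"
    using base_of_heights[OF pp, of h] by blast
  have "ht B i = ht L i" using B(2)[of i] ij by (simp add: h_def)
  moreover have "ht B j = min (ht U j) (ht L i + (j - i))" using B(2)[of j] ij LU[of i] by (auto simp: h_def)
  ultimately show ?thesis
    using card_base_Int_le_rk[OF matroid_lpm[OF pp] B(1), of "{i<..j}"] card_Int_interval[OF ij(1), of B] by simp
qed

lemma card_base_cointerval:
  assumes "path_pair n U L" "B \<in> bases (lpm n U L)" "i \<le> j" "j \<le> n"
  shows "card (B \<inter> ({1..n} - {i<..j})) + ht B j = card U + ht B i"
proof -
  have B: "B \<subseteq> {1..n}" "card B = card U" "finite B"
    using assms(2) finite_subset unfolding bases_lpm_iff[OF assms(1)] by blast+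
  have "B = (B \<inter> ({1..n} - {i<..j})) \<union> (B \<inter> {i<..j})" using B(1) by blast
  moreover have "(B \<inter> ({1..n} - {i<..j})) \<inter> (B \<inter> {i<..j}) = {}" by blast
  ultimately have "card B = card (B \<inter> ({1..n} - {i<..j})) + card (B \<inter> {i<..j})"
    using card_Un_disjoint B(3) by (metis finite_Int)
  then show ?thesis using card_Int_interval[OF assms(3), of B] B(2) by simp
qed

lemma rk_lpm_cointerval_le:
  assumes pp: "path_pair n U L" and ij: "i \<le> j" "j \<le> n"
  shows "rk (lpm n U L) ({1..n} - {i<..j}) + ht L j \<le> card U + ht U i"
proof -
  have le: "ht L j \<le> card U + ht U i" using ht_path_pair_end[OF pp, of n] ht_mono[OF ij(2), of L] by simp
  have "rk (lpm n U L) ({1..n} - {i<..j}) \<le> card U + ht U i - ht L j"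
  proof (rule rk_le_if_bases[OF matroid_lpm[OF pp]])
    fix B assume B: "B \<in> bases (lpm n U L)"
    then have "ht L j \<le> ht B j" "ht B i \<le> ht U i" by (simp_all add: bases_lpm_iff[OF pp])
    then show "card (B \<inter> ({1..n} - {i<..j})) \<le> card U + ht U i - ht L j"
      using card_base_cointerval[OF pp B ij] by linarith
  qed
  then show ?thesis using le by simp
qed

text \<open>The witness follows the upper path up to \<open>i\<close>, then goes East until the
  lower path forces it North, so it takes as little of the interval as possible.\<close>

lemma rk_lpm_cointerval_ge:
  assumes pp: "path_pair n U L" and ij: "i \<le> j" "j \<le> n"
  shows "card U + ht U i \<le> rk (lpm n U L) ({1..n} - {i<..j}) + max (ht L j) (ht U i)"
proof -
  define h where "h t = (if t \<le> i then ht U t else max (ht L t) (ht U i))" for t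
  have LU: "ht L t \<le> ht U t" for t using pp by (simp add: path_pair_iff)
  have "0 \<notin> U" using pp by (auto simp: path_pair_def)
  then have "h 0 = 0" by (simp add: h_def ht_zero)
  moreover have "h t \<le> h (Suc t) \<and> h (Suc t) \<le> Suc (h t)" for t
    using LU[of i] ht_Suc[of U t] ht_Suc[of L t]
    by (cases "t < i"; cases "t = i") (auto simp: h_def)
  moreover have "ht L t \<le> h t \<and> h t \<le> ht U t" for t
    using LU[of t] ht_mono[of i t U] by (auto simp: h_def)
  ultimately obtain B where B: "B \<in> bases (lpm n U L)" "\<And>t. t \<le> n \<Longrightarrow> ht B t = h t"
    using base_of_heights[OF pp, of h] by blast
  have "ht B i = ht U i" using B(2)[of i] ij by (simp add: h_def)
  moreover have "ht B j = max (ht L j) (ht U i)" using B(2)[of j] ij LU[of i] by (auto simp: h_def)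
  ultimately show ?thesis
    using card_base_Int_le_rk[OF matroid_lpm[OF pp] B(1), of "{1..n} - {i<..j}"]
      card_base_cointerval[OF pp B(1) ij] by simp
qed

section \<open>Covers and falling chains\<close>

text \<open>The two disjunctions are what the rank inequality of a quotient says for an interval and for
  the complement of an interval.\<close>

definition height_quotient :: "nat \<Rightarrow> nat set \<Rightarrow> nat set \<Rightarrow> nat set \<Rightarrow> nat set \<Rightarrow> bool" where
  "height_quotient n U' L' U L \<longleftrightarrow> U' \<subseteq> U \<and> L' \<subseteq> L \<and>
     (\<forall>i j. i \<le> j \<longrightarrow> j \<le> n \<longrightarrow> j + ht L i \<le> i + ht U j \<or> ht U' j + ht L i \<le> ht U j + ht L' i) \<and>
     (\<forall>i j. i \<le> j \<longrightarrow> j \<le> n \<longrightarrow> ht L' j \<le> ht U' i \<or> ht L' j + ht U i \<le> ht L j + ht U' i)"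

lemma rank_quotient_imp_height_quotient:
  assumes pp: "path_pair n U L" and pp': "path_pair n U' L'"
    and q: "rank_quotient (lpm n U' L') (lpm n U L)"
  shows "height_quotient n U' L' U L"
  unfolding height_quotient_def
proof (intro conjI allI impI)
  let ?r = "rk (lpm n U L)" and ?r' = "rk (lpm n U' L')"
  have qrk: "?r' Y + ?r X \<le> ?r Y + ?r' X" if "X \<subseteq> Y" "Y \<subseteq> {1..n}" for X Y
    using q that unfolding rank_quotient_def ground_lpm by blast
  note rk0 = rk_empty[OF matroid_lpm[OF pp]] rk_empty[OF matroid_lpm[OF pp']]
  show "U' \<subseteq> U"
  proof
    fix e assume e: "e \<in> U'"
    then obtain t where t: "e = Suc t" "Suc t \<le> n" using pp' unfolding path_pair_def by (cases e) auto
    \<comment> \<open>For two consecutive initial segments the rank inequality says that a North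
      step of \<open>U'\<close> is one of \<open>U\<close>. Final segments do the same for the lower
      paths.\<close>
    have "ht U' (Suc t) + ht U t \<le> ht U (Suc t) + ht U' t"
      using qrk[of "{0<..t}" "{0<..Suc t}"] rk_lpm_initial[OF pp, of t] rk_lpm_initial[OF pp, of "Suc t"]
        rk_lpm_initial[OF pp', of t] rk_lpm_initial[OF pp', of "Suc t"] t by fastforce
    then show "e \<in> U" using e unfolding t ht_Suc by (simp split: if_splits)
  qed
  show "L' \<subseteq> L"
  proof
    fix e assume e: "e \<in> L'"
    then obtain t where t: "e = Suc t" "Suc t \<le> n" using pp' unfolding path_pair_def by (cases e) auto
    have "?r' {t<..n} + ?r {Suc t<..n} \<le> ?r {t<..n} + ?r' {Suc t<..n}" by (intro qrk) auto
    then have "ht L' (Suc t) + ht L t \<le> ht L (Suc t) + ht L' t"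
      using rk_lpm_final[OF pp, of t] rk_lpm_final[OF pp, of "Suc t"]
        rk_lpm_final[OF pp', of t] rk_lpm_final[OF pp', of "Suc t"] t by linarith
    then show "e \<in> L" using e unfolding t ht_Suc by (simp split: if_splits)
  qed
  fix i j :: nat assume ij: "i \<le> j" "j \<le> n"
  \<comment> \<open>The interval is compared with the empty set; the two terms of the minimum in
    \<open>rk_lpm_interval_ge\<close> yield the two alternatives.\<close>
  have "?r' {i<..j} + ?r {} \<le> ?r {i<..j} + ?r' {}" using ij by (intro qrk) auto
  then show "j + ht L i \<le> i + ht U j \<or> ht U' j + ht L i \<le> ht U j + ht L' i"
    using rk_lpm_interval_le[OF pp ij(1)] rk_lpm_interval_ge[OF pp' ij] rk0 ij(1) by linarith
  \<comment> \<open>The complement is compared with the whole ground set; here the terms of the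
    maximum in \<open>rk_lpm_cointerval_ge\<close> yield the alternatives.\<close>
  have "?r' {0<..n} + ?r ({1..n} - {i<..j}) \<le> ?r {0<..n} + ?r' ({1..n} - {i<..j})"
    by (intro qrk) auto
  moreover have "?r {0<..n} = card U" "?r' {0<..n} = card U'"
    using rk_lpm_initial[OF pp, of n] rk_lpm_initial[OF pp', of n]
      ht_path_pair_end[OF pp, of n] ht_path_pair_end[OF pp', of n] by simp_all
  ultimately show "ht L' j \<le> ht U' i \<or> ht L' j + ht U i \<le> ht L j + ht U' i"
    using rk_lpm_cointerval_le[OF pp' ij] rk_lpm_cointerval_ge[OF pp ij] by linarith
qed

text \<open>Minima are chosen because \<open>U\<close> and \<open>U'\<close> have equal heights
  before \<open>a\<close>, and \<open>L\<close> and \<open>L'\<close> before \<open>b\<close>. Taken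
  from the earlier of the two steps to just before the later one, the second alternative of a
  disjunction fails, and the first is an inequality of the good pair.\<close>

lemma height_quotient_step:
  assumes pp: "path_pair n U L" and pp': "path_pair n U' L'" and hq: "height_quotient n U' L' U L"
    and ne: "U' \<noteq> U"
  obtains a b where "a \<in> U - U'" "good_pair U L b a" "path_pair n (U - {a}) (L - {b})"
    "height_quotient n U' L' (U - {a}) (L - {b})"
proof -
  have sub: "U' \<subseteq> U" "L' \<subseteq> L" using hq by (simp_all add: height_quotient_def)
  have fin: "finite U" "finite L" using path_pair_finite[OF pp] by simp_all
  have "card U' < card U" using sub ne fin by (intro psubset_card_mono) auto
  then have "L' \<noteq> L" using pp pp' unfolding path_pair_iff by auto
  define a where "a = Min (U - U')"
  define b where "b = Min (L - L')"
  have a: "a \<in> U" "a \<notin> U'" using Min_in[of "U - U'"] fin sub ne unfolding a_def by auto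
  have b: "b \<in> L" "b \<notin> L'" using Min_in[of "L - L'"] fin sub \<open>L' \<noteq> L\<close> unfolding b_def by auto
  have n: "1 \<le> a" "a \<le> n" "1 \<le> b" "b \<le> n" using a b pp unfolding path_pair_def by auto
  have beforeU: "ht U t = ht U' t" if "t < a" for t
  proof -
    have "U \<inter> {..t} = U' \<inter> {..t}" using sub that Min_le[of "U - U'"] fin unfolding a_def by fastforce
    then show ?thesis by (simp add: ht_def)
  qed
  have beforeL: "ht L t = ht L' t" if "t < b" for t
  proof -
    have "L \<inter> {..t} = L' \<inter> {..t}" using sub that Min_le[of "L - L'"] fin unfolding b_def by fastforce
    then show ?thesis by (simp add: ht_def)
  qed
  have rU: "ht U t = ht (U - {a}) t + (if a \<le> t then 1 else 0)" for t using a by (intro ht_remove)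
  have rL: "ht L t = ht (L - {b}) t + (if b \<le> t then 1 else 0)" for t using b by (intro ht_remove)
  have leU: "ht U' t \<le> ht (U - {a}) t" for t using sub a by (intro ht_mono_set) auto
  have leL: "ht L' t \<le> ht (L - {b}) t" for t using sub b by (intro ht_mono_set) auto
  have I: "j + ht L i \<le> i + ht U j \<or> ht U' j + ht L i \<le> ht U j + ht L' i"
    and II: "ht L' j \<le> ht U' i \<or> ht L' j + ht U i \<le> ht L j + ht U' i" if "i \<le> j" "j \<le> n" for i j
    using hq that unfolding height_quotient_def by blast+
  have LU: "ht L t \<le> ht U t" and LU': "ht L' t \<le> ht U' t" for t
    using pp pp' unfolding path_pair_iff by simp_all
  have pp'': "path_pair n (U - {a}) (L - {b})"
    unfolding path_pair_iff
  proof (intro conjI allI)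
    show "card (U - {a}) = card (L - {b})" using a b fin pp unfolding path_pair_iff by simp
    show "ht (L - {b}) t \<le> ht (U - {a}) t" for t
    \<comment> \<open>Only here has the upper path dropped while the lower one has not. But there
      the lower path still has the heights of \<open>L'\<close>, which lies below
      \<open>U'\<close>.\<close>
    proof (cases "a \<le> t \<and> t < b")
      case True
      then have "ht (L - {b}) t = ht L' t" using rL[of t] beforeL[of t] by simp
      then show ?thesis using LU'[of t] leU[of t] by simp
    next
      case False
      then show ?thesis using rU[of t] rL[of t] LU[of t] by (auto split: if_splits)
    qed
  qed (use pp in \<open>auto simp: path_pair_iff\<close>)
  have Suc_a: "ht U a = Suc (ht U' (a - 1))" and Suc_b: "ht L b = Suc (ht L' (b - 1))"
  proof -
    show "ht U a = Suc (ht U' (a - 1))" using ht_Suc[of U "a - 1"] beforeU[of "a - 1"] a n by simp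
    show "ht L b = Suc (ht L' (b - 1))" using ht_Suc[of L "b - 1"] beforeL[of "b - 1"] b n by simp
  qed
  have "ht U' a = ht U' (a - 1)" using ht_Suc[of U' "a - 1"] a n by simp
  have "ht L' b = ht L' (b - 1)" using ht_Suc[of L' "b - 1"] b n by simp
  have "ht L b \<le> ht U a"
  proof (cases "a < b")
    case True
    then have "ht L' (b - 1) \<le> ht U' a"
      using II[of a "b - 1"] beforeL[of "b - 1"] Suc_a \<open>ht U' a = _\<close> n by linarith
    then show ?thesis using Suc_a Suc_b \<open>ht U' a = _\<close> by simp
  next
    case False
    then show ?thesis using ht_mono[of b a L] LU[of a] by simp
  qed
  moreover have "a + ht L b \<le> b + ht U a"
  proof (cases "b < a")
    case True
    then have "a - 1 + ht L b \<le> b + ht U (a - 1)"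
      using I[of b "a - 1"] beforeU[of "a - 1"] Suc_b \<open>ht L' b = _\<close> n by linarith
    then show ?thesis using Suc_a beforeU[of "a - 1"] n by simp
  next
    case False
    then show ?thesis using ht_le_add[of a b L] LU[of a] by simp
  qed
  ultimately have "good_pair U L b a" using a b by (simp add: good_pair_def)
  moreover have "height_quotient n U' L' (U - {a}) (L - {b})"
    unfolding height_quotient_def
  proof (intro conjI allI impI)
    show "U' \<subseteq> U - {a}" "L' \<subseteq> L - {b}" using sub a b by auto
    fix i j :: nat assume ij: "i \<le> j" "j \<le> n"
    show "j + ht (L - {b}) i \<le> i + ht (U - {a}) j \<or> ht U' j + ht (L - {b}) i \<le> ht (U - {a}) j + ht L' i"
    \<comment> \<open>For \<open>b \<le> i\<close> the left side of each alternative drops by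
      exactly one and the right side by at most one. Otherwise the second alternative reduces to
      \<open>U' \<subseteq> U - {a}\<close>.\<close>
    proof (cases "b \<le> i")
      case True
      have "ht L i = ht (L - {b}) i + 1" "ht U j \<le> ht (U - {a}) j + 1" using rL[of i] rU[of j] True by simp_all
      then show ?thesis using I[OF ij] by linarith
    next
      case False
      then have "ht (L - {b}) i = ht L' i" using rL[of i] beforeL[of i] by simp
      then show ?thesis using leU[of j] by simp
    qed
    show "ht L' j \<le> ht U' i \<or> ht L' j + ht (U - {a}) i \<le> ht (L - {b}) j + ht U' i"
    proof (cases "a \<le> i")
      case True
      have "ht U i = ht (U - {a}) i + 1" "ht L j \<le> ht (L - {b}) j + 1" using rU[of i] rL[of j] True by simp_all
      then show ?thesis using II[OF ij] by linarith
    next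
      case False
      then have "ht (U - {a}) i = ht U' i" using rU[of i] beforeU[of i] by simp
      then show ?thesis using leL[of j] by simp
    qed
  qed
  ultimately show ?thesis using that a pp'' by blast
qed

text \<open>Pairs of least removed steps are peeled off one at a time, and transitivity of the rank
  inequality composes the removals.\<close>

lemma height_quotient_imp_rank_quotient:
  assumes "path_pair n U L" "path_pair n U' L'" "height_quotient n U' L' U L"
  shows "rank_quotient (lpm n U' L') (lpm n U L)"
  using assms(1,3)
proof (induction "card U" arbitrary: U L rule: less_induct)
  case less
  show ?case
  proof (cases "U' = U")
    case True
    have "card L' = card L" using True less.prems(1) assms(2) by (simp add: path_pair_iff)
    then have "L' = L"
      using less.prems(2) path_pair_finite[OF less.prems(1)] card_subset_eq
      unfolding height_quotient_def by blast
    then show ?thesis using True rank_quotient_refl by simp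
  next
    case False
    then obtain a b where ab: "a \<in> U - U'" "good_pair U L b a" "path_pair n (U - {a}) (L - {b})"
      "height_quotient n U' L' (U - {a}) (L - {b})"
      using height_quotient_step[OF less.prems(1) assms(2) less.prems(2)] by blast
    have "card (U - {a}) < card U"
      using ab(1) path_pair_finite[OF less.prems(1)] by (intro card_Diff1_less) auto
    from less.hyps[OF this ab(3,4)] good_pair_rank_quotient[OF less.prems(1) ab(3,2)]
    show ?thesis by (rule rank_quotient_trans)
  qed
qed

lemma lpm_quotient_iff:
  assumes "path_pair n U L" "path_pair n U' L'"
  shows "lpm n U' L' \<le>\<^sub>q lpm n U L \<longleftrightarrow> height_quotient n U' L' U L"
  using rank_quotient_imp_height_quotient[OF assms] height_quotient_imp_rank_quotient[OF assms]
    quotient_imp_rank_quotient[OF _ matroid_lpm[OF assms(2)]]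
    rank_quotient_imp_quotient[OF matroid_lpm[OF assms(1)] matroid_lpm[OF assms(2)]] by blast

section \<open>Covers as removals of good pairs\<close>

lemma lpm_in_poset: "path_pair n U L \<Longrightarrow> lpm n U L \<in> lpm_poset n"
  unfolding lpm_poset_def by blast

lemma good_pair_quotient:
  assumes "path_pair n U L" "path_pair n (U - {u}) (L - {l})" "good_pair U L l u"
  shows "lpm n (U - {u}) (L - {l}) \<le>\<^sub>q lpm n U L"
  using rank_quotient_imp_quotient[OF matroid_lpm matroid_lpm] good_pair_rank_quotient assms by blast

text \<open>Removing only the pair of least removed steps gives a matroid of the poset between
  \<open>x\<close> and the given one and different from the latter, so it must be
  \<open>x\<close>.\<close>

lemma covered_by_imp_good_pair:
  assumes cov: "covered_by n x (lpm n U L)" and pp: "path_pair n U L"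
  obtains u l where "good_pair U L l u" "path_pair n (U - {u}) (L - {l})" "x = lpm n (U - {u}) (L - {l})"
proof -
  have x: "x \<in> lpm_poset n" "x \<le>\<^sub>q lpm n U L" "x \<noteq> lpm n U L"
    and no: "\<And>z. z \<in> lpm_poset n \<Longrightarrow> x \<le>\<^sub>q z \<Longrightarrow> x \<noteq> z \<Longrightarrow> z \<le>\<^sub>q lpm n U L \<Longrightarrow> z = lpm n U L"
    using cov unfolding covered_by_def by blast+
  obtain U' L' where x': "x = lpm n U' L'" and pp': "path_pair n U' L'"
    using x(1) unfolding lpm_poset_def by blast
  have hq: "height_quotient n U' L' U L" using x(2) lpm_quotient_iff[OF pp pp'] x' by simp
  have "U' \<noteq> U"
  proof
    assume "U' = U"
    moreover from this have "card L' = card L" using pp pp' by (simp add: path_pair_iff)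
    then have "L' = L"
      using hq path_pair_finite[OF pp] card_subset_eq unfolding height_quotient_def by blast
    ultimately show False using x(3) x' by simp
  qed
  then obtain a b where ab: "a \<in> U - U'" "good_pair U L b a" "path_pair n (U - {a}) (L - {b})"
    "height_quotient n U' L' (U - {a}) (L - {b})"
    using height_quotient_step[OF pp pp' hq] by blast
  let ?z = "lpm n (U - {a}) (L - {b})"
  have "x \<le>\<^sub>q ?z" using lpm_quotient_iff[OF ab(3) pp'] ab(4) x' by simp
  moreover have "?z \<noteq> lpm n U L" using lpm_inject[OF ab(3) pp] ab(1) by blast
  ultimately have "x = ?z"
    using no[OF lpm_in_poset[OF ab(3)]] good_pair_quotient[OF pp ab(3,2)] by blast
  then show ?thesis using that ab(2,3) by blast
qed

text \<open>A matroid in between has its upper set between \<open>U - {u}\<close> and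
  \<open>U\<close>, and its lower set between \<open>L - {l}\<close> and \<open>L\<close>. Equal
  cardinalities exclude that only one of \<open>u\<close> and \<open>l\<close> is removed.\<close>

lemma good_pair_imp_covered_by:
  assumes pp: "path_pair n U L" and pp': "path_pair n (U - {u}) (L - {l})" and good: "good_pair U L l u"
  shows "covered_by n (lpm n (U - {u}) (L - {l})) (lpm n U L)"
proof -
  have u: "u \<in> U" "l \<in> L" using good by (simp_all add: good_pair_def)
  have "z = lpm n (U - {u}) (L - {l}) \<or> z = lpm n U L"
    if z0: "z \<in> lpm_poset n" "lpm n (U - {u}) (L - {l}) \<le>\<^sub>q z" "z \<le>\<^sub>q lpm n U L" for z
  proof -
    obtain V W where z: "z = lpm n V W" "path_pair n V W" using z0(1) unfolding lpm_poset_def by blast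
    have "height_quotient n (U - {u}) (L - {l}) V W" "height_quotient n V W U L"
      using z0(2,3) lpm_quotient_iff[OF pp z(2)] lpm_quotient_iff[OF z(2) pp'] z(1) by simp_all
    then have "U - {u} \<subseteq> V" "V \<subseteq> U" "L - {l} \<subseteq> W" "W \<subseteq> L"
      by (simp_all add: height_quotient_def)
    then have V: "V = U - {u} \<or> V = U" and W: "W = L - {l} \<or> W = L" by blast+
    have "card V = card W" "card U = card L" using z(2) pp unfolding path_pair_iff by blast+
    moreover have "card (U - {u}) < card U" "card (L - {l}) < card L"
      using u path_pair_finite[OF pp] by (simp_all only: card_Diff1_less)
    moreover have "card (U - {u}) = card (L - {l})" using pp' by (simp add: path_pair_iff)
    ultimately show ?thesis using V W z(1) by (metis less_irrefl)
  qed
  moreover have "lpm n (U - {u}) (L - {l}) \<noteq> lpm n U L" using lpm_inject[OF pp' pp] u by blast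
  ultimately show ?thesis
    unfolding covered_by_def using lpm_in_poset pp pp' good_pair_quotient[OF pp pp' good] by blast
qed

lemma cover_label_lpm:
  assumes "path_pair n U L" "path_pair n (U - {u}) (L - {l})" "u \<in> U" "l \<in> L"
  shows "cover_label n (lpm n (U - {u}) (L - {l})) (lpm n U L) = (l, u)"
  using assms by (intro cover_label_eq) (auto simp: has_label_def)

section \<open>Moving the North step \<open>k + 1\<close> to \<open>k\<close>\<close>

text \<open>Not the transposition: \<open>k\<close> stays fixed, so the map is injective and
  strictly increasing only away from \<open>k\<close>.\<close>

definition step_down :: "nat \<Rightarrow> nat \<Rightarrow> nat" where
  "step_down k v = (if v = Suc k then k else v)"

lemma step_down_less_iff: "v \<noteq> k \<Longrightarrow> w \<noteq> k \<Longrightarrow> step_down k v < step_down k w \<longleftrightarrow> v < w"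
  by (auto simp: step_down_def)

lemma inj_on_step_down: "inj_on (step_down k) (- {k})"
  by (auto simp: inj_on_def step_down_def split: if_splits)

text \<open>East at \<open>k\<close> followed by North at \<open>k + 1\<close> becomes North
  followed by East, so the path changes only after exactly \<open>k\<close> steps.\<close>

lemma ht_step_down:
  assumes "k \<notin> U"
  shows "ht (step_down k ` U) t = ht U t + (if t = k \<and> Suc k \<in> U then 1 else 0)"
proof (cases "Suc k \<in> U")
  case True
  then have "step_down k ` U = insert k (U - {Suc k})" by (auto simp: step_down_def image_iff)
  moreover have "insert k (U - {Suc k}) - {k} = U - {Suc k}" using assms by auto
  ultimately have "ht (step_down k ` U) t = ht (U - {Suc k}) t + (if k \<le> t then 1 else 0)"
    using ht_remove[of k "insert k (U - {Suc k})" t] by simp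
  then show ?thesis using ht_remove[OF True, of t] True by simp
next
  case False
  then have "step_down k ` U = U" by (auto simp: step_down_def image_iff)
  then show ?thesis using False by simp
qed

lemma path_pair_step_down:
  assumes "path_pair n U L" "k \<notin> U" "1 \<le> k"
  shows "path_pair n (step_down k ` U) L"
  unfolding path_pair_iff
proof (intro conjI allI)
  have "inj_on (step_down k) U" using assms(2) by (intro inj_on_subset[OF inj_on_step_down]) auto
  then show "card (step_down k ` U) = card L" using assms(1) by (simp add: card_image path_pair_iff)
  show "step_down k ` U \<subseteq> {1..n}" using assms by (auto simp: path_pair_def step_down_def)
  show "ht L t \<le> ht (step_down k ` U) t" for t
    using assms(1) unfolding ht_step_down[OF assms(2)] path_pair_iff by (simp add: le_Suc_eq)
qed (use assms in \<open>simp add: path_pair_def\<close>)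

lemma good_pair_step_down:
  assumes "good_pair U L l u" "k \<notin> U"
  shows "good_pair (step_down k ` U) L l (step_down k u)"
proof -
  have u: "u \<in> U" "u \<noteq> k" using assms by (auto simp: good_pair_def)
  \<comment> \<open>For \<open>u = k + 1\<close> the height is now read at \<open>k\<close>, exactly
    where it has gained one. Any other \<open>u\<close> differs from \<open>k\<close> and misses
    that position.\<close>
  have "ht (step_down k ` U) (step_down k u) = ht U u"
    using u unfolding ht_step_down[OF assms(2)] by (auto simp: step_down_def ht_Suc)
  moreover have "step_down k u \<le> u" by (simp add: step_down_def)
  ultimately show ?thesis using assms(1) u(1) unfolding good_pair_def by auto
qed

text \<open>Chains consist of matroids, so the bounding paths are first recovered by inverting
  \<open>lpm\<close>, which \<open>lpm_inject\<close> permits. The position of the North step gets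
  lower; the upper path itself rises.\<close>

definition lower_upper_path :: "nat \<Rightarrow> nat \<Rightarrow> nat basis_system \<Rightarrow> nat basis_system" where
  "lower_upper_path n k M =
     (case inv_into {(U, L). path_pair n U L} (\<lambda>(U, L). lpm n U L) M of (U, L) \<Rightarrow> lpm n (step_down k ` U) L)"

lemma lower_upper_path_lpm:
  assumes "path_pair n U L"
  shows "lower_upper_path n k (lpm n U L) = lpm n (step_down k ` U) L"
proof -
  have "inj_on (\<lambda>(U, L). lpm n U L) {(U, L). path_pair n U L}"
    using lpm_inject by (auto simp: inj_on_def)
  then have "inv_into {(U, L). path_pair n U L} (\<lambda>(U, L). lpm n U L) (lpm n U L) = (U, L)"
    using inv_into_f_f[of _ _ "(U, L)"] assms by fastforce
  then show ?thesis by (simp add: lower_upper_path_def)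
qed

lemma inj_on_lower_upper_path:
  assumes "1 \<le> k"
  shows "inj_on (lower_upper_path n k) {lpm n U L |U L. path_pair n U L \<and> k \<notin> U}"
proof (rule inj_onI, clarify)
  fix U L V W
  assume UL: "path_pair n U L" "k \<notin> U" and VW: "path_pair n V W" "k \<notin> V"
    and "lower_upper_path n k (lpm n U L) = lower_upper_path n k (lpm n V W)"
  then have "step_down k ` U = step_down k ` V \<and> L = W"
    using lpm_inject[OF path_pair_step_down[OF UL assms] path_pair_step_down[OF VW assms]]
    by (simp add: lower_upper_path_lpm)
  moreover have "U \<subseteq> - {k}" "V \<subseteq> - {k}" using UL VW by auto
  ultimately show "lpm n U L = lpm n V W" using inj_on_image_eq_iff[OF inj_on_step_down] by metis
qed

text \<open>Both labels are recorded, with \<open>u \<noteq> k\<close>, because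
  \<open>falling\<close> compares consecutive labels and \<open>step_down\<close> preserves that
  comparison only away from \<open>k\<close>.\<close>

lemma covered_by_lower_upper_path:
  assumes "covered_by n x (lpm n U L)" "path_pair n U L" "k \<notin> U" "1 \<le> k"
  shows "\<exists>l u. u \<noteq> k \<and> covered_by n (lower_upper_path n k x) (lower_upper_path n k (lpm n U L)) \<and>
    cover_label n x (lpm n U L) = (l, u) \<and>
    cover_label n (lower_upper_path n k x) (lower_upper_path n k (lpm n U L)) = (l, step_down k u)"
proof -
  obtain u l where ul: "good_pair U L l u" "path_pair n (U - {u}) (L - {l})" "x = lpm n (U - {u}) (L - {l})"
    using covered_by_imp_good_pair[OF assms(1,2)] .
  have mem: "u \<in> U" "l \<in> L" using ul(1) by (auto simp: good_pair_def)
  have "inj_on (step_down k) U" using assms(3) by (intro inj_on_subset[OF inj_on_step_down]) auto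
  then have im: "step_down k ` (U - {u}) = step_down k ` U - {step_down k u}"
    using mem by (simp add: inj_on_image_set_diff[of _ U])
  have pp: "path_pair n (step_down k ` U) L" using path_pair_step_down assms(2-4) by blast
  have pp': "path_pair n (step_down k ` U - {step_down k u}) (L - {l})"
    using path_pair_step_down[OF ul(2), of k] assms(3,4) im by simp
  have x: "lower_upper_path n k x = lpm n (step_down k ` U - {step_down k u}) (L - {l})"
    unfolding ul(3) lower_upper_path_lpm[OF ul(2)] im ..
  have "covered_by n (lower_upper_path n k x) (lower_upper_path n k (lpm n U L))"
    unfolding x lower_upper_path_lpm[OF assms(2)]
    by (rule good_pair_imp_covered_by[OF pp pp' good_pair_step_down[OF ul(1) assms(3)]])
  moreover have "cover_label n x (lpm n U L) = (l, u)"
    unfolding ul(3) by (rule cover_label_lpm[OF assms(2) ul(2) mem])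
  moreover have "cover_label n (lower_upper_path n k x) (lower_upper_path n k (lpm n U L)) = (l, step_down k u)"
    unfolding x lower_upper_path_lpm[OF assms(2)] using mem by (intro cover_label_lpm[OF pp pp']) auto
  moreover have "u \<noteq> k" using mem assms(3) by blast
  ultimately show ?thesis by blast
qed

section \<open>Transport of falling maximal chains\<close>

lemma saturated_chain_Cons:
  "saturated_chain n (x # y # ys) \<longleftrightarrow> covered_by n x y \<and> saturated_chain n (y # ys)"
proof
  assume *: "saturated_chain n (x # y # ys)"
  then have "covered_by n ((x # y # ys) ! i) ((x # y # ys) ! Suc i)" if "Suc i < length (x # y # ys)" for i
    using that unfolding saturated_chain_def by blast
  from this[of 0] this[of "Suc _"] * show "covered_by n x y \<and> saturated_chain n (y # ys)"
    unfolding saturated_chain_def by auto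
next
  assume "covered_by n x y \<and> saturated_chain n (y # ys)"
  then show "saturated_chain n (x # y # ys)"
    unfolding saturated_chain_def by (auto simp: covered_by_def nth_Cons split: nat.splits)
qed

lemma saturated_chain_below:
  assumes "saturated_chain n xs" "last xs = lpm n V W" "path_pair n V W"
  shows "\<forall>x\<in>set xs. \<exists>U L. path_pair n U L \<and> x = lpm n U L \<and> U \<subseteq> V"
    and "length xs \<le> Suc (card V)"
proof -
  \<comment> \<open>Lists run upwards, so the induction adds a new bottom. The second conjunct
    carries the paths of the current bottom and counts one removed North step per cover.\<close>
  have "(\<forall>x\<in>set xs. \<exists>U L. path_pair n U L \<and> x = lpm n U L \<and> U \<subseteq> V) \<and>
    (\<exists>U L. path_pair n U L \<and> hd xs = lpm n U L \<and> U \<subseteq> V \<and> card U + length xs = Suc (card V))"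
    using assms(1,2)
  proof (induction xs rule: induct_list012)
    case 1
    then show ?case by (simp add: saturated_chain_def)
  next
    case (2 x)
    then show ?case using assms(3) by auto
  next
    case (3 x y ys)
    have cov: "covered_by n x y" and "saturated_chain n (y # ys)"
      using 3(3) unfolding saturated_chain_Cons by blast+
    then have IH: "\<forall>x\<in>set (y # ys). \<exists>U L. path_pair n U L \<and> x = lpm n U L \<and> U \<subseteq> V"
      "\<exists>U L. path_pair n U L \<and> y = lpm n U L \<and> U \<subseteq> V \<and> card U + length (y # ys) = Suc (card V)"
      using 3(2,4) by auto
    then obtain U L where UL: "path_pair n U L" "y = lpm n U L" "U \<subseteq> V" "card U + length (y # ys) = Suc (card V)"
      by blast
    obtain u l where ul: "good_pair U L l u" "path_pair n (U - {u}) (L - {l})" "x = lpm n (U - {u}) (L - {l})"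
      using covered_by_imp_good_pair[of n x U L] cov UL(1,2) by metis
    have "Suc (card (U - {u})) = card U"
      using ul(1) path_pair_finite[OF UL(1)] by (intro card_Suc_Diff1) (auto simp: good_pair_def)
    then have "card (U - {u}) + length (x # y # ys) = Suc (card V)" using UL(4) by simp
    moreover have "U - {u} \<subseteq> V" using UL(3) by blast
    ultimately show ?case using IH(1) ul(2,3) by (metis list.sel(1) set_ConsD)
  qed
  then show "\<forall>x\<in>set xs. \<exists>U L. path_pair n U L \<and> x = lpm n U L \<and> U \<subseteq> V" "length xs \<le> Suc (card V)"
    by auto
qed

lemma path_pair_coatom:
  assumes "1 \<le> k" "k \<le> n"
  shows "path_pair n ({1..n} - {k}) ({1..n} - {1})"
  unfolding path_pair_iff
proof (intro conjI allI)
  fix t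
  have "ht {1..n} t = ht ({1..n} - {k}) t + (if k \<le> t then 1 else 0)" using assms by (intro ht_remove) simp
  moreover have "ht {1..n} t = ht ({1..n} - {1}) t + (if 1 \<le> t then 1 else 0)" using assms by (intro ht_remove) simp
  ultimately show "ht ({1..n} - {1}) t \<le> ht ({1..n} - {k}) t" using assms by (simp split: if_splits)
qed (use assms in auto)

text \<open>An infinite set has \<open>card\<close> 0, so comparing cardinalities along an injection
  requires a finite target.\<close>

lemma finite_FC:
  assumes "1 \<le> k" "k \<le> n"
  shows "finite (FC n k)"
proof -
  have "lpm_poset n \<subseteq> (\<lambda>(U, L). lpm n U L) ` (Pow {1..n} \<times> Pow {1..n})"
    by (auto simp: lpm_poset_def path_pair_def)
  then have "finite (lpm_poset n)" by (rule finite_subset) simp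
  then have "finite {xs. set xs \<subseteq> lpm_poset n \<and> length xs \<le> Suc (card ({1..n} - {k}))}"
    by (rule finite_lists_length_le)
  moreover have "FC n k \<subseteq> {xs. set xs \<subseteq> lpm_poset n \<and> length xs \<le> Suc (card ({1..n} - {k}))}"
  proof
    fix xs assume "xs \<in> FC n k"
    then have "saturated_chain n xs" "last xs = lpm n ({1..n} - {k}) ({1..n} - {1})"
      by (simp_all add: FC_def maximal_chains_def)
    then show "xs \<in> {xs. set xs \<subseteq> lpm_poset n \<and> length xs \<le> Suc (card ({1..n} - {k}))}"
      using saturated_chain_below(2) path_pair_coatom[OF assms] unfolding saturated_chain_def by blast
  qed
  ultimately show ?thesis by (rule finite_subset[rotated])
qed

lemma FC_elements:
  assumes "1 \<le> k" "k \<le> n" "xs \<in> FC n k"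
  shows "set xs \<subseteq> {lpm n U L |U L. path_pair n U L \<and> k \<notin> U}"
proof -
  have "saturated_chain n xs" "last xs = lpm n ({1..n} - {k}) ({1..n} - {1})"
    using assms(3) by (simp_all add: FC_def maximal_chains_def)
  from saturated_chain_below(1)[OF this path_pair_coatom[OF assms(1,2)]] show ?thesis by blast
qed

lemma map_lower_upper_path_FC:
  assumes k: "1 \<le> k" "Suc k \<le> n" and xs: "xs \<in> FC n k"
  shows "map (lower_upper_path n k) xs \<in> FC n (Suc k)"
proof -
  let ?f = "lower_upper_path n k"
  have sat: "saturated_chain n xs" and hd: "hd xs = lpm n {} {}"
    and last: "last xs = lpm n ({1..n} - {k}) ({1..n} - {1})" and fall: "falling n xs"
    using xs by (simp_all add: FC_def maximal_chains_def)
  have ne: "xs \<noteq> []" using sat by (simp add: saturated_chain_def)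
  have elem: "\<exists>U L. path_pair n U L \<and> k \<notin> U \<and> x = lpm n U L" if "x \<in> set xs" for x
    using FC_elements[OF k(1) Suc_leD[OF k(2)] xs] that by blast
  have step: "\<exists>l u. u \<noteq> k \<and> covered_by n (?f (xs ! i)) (?f (xs ! Suc i)) \<and>
      cover_label n (xs ! i) (xs ! Suc i) = (l, u) \<and>
      cover_label n (?f (xs ! i)) (?f (xs ! Suc i)) = (l, step_down k u)"
    if i: "Suc i < length xs" for i
  proof -
    obtain U L where UL: "path_pair n U L" "k \<notin> U" "xs ! Suc i = lpm n U L"
      using elem[OF nth_mem[OF i]] by blast
    have "covered_by n (xs ! i) (lpm n U L)" using sat i UL(3) unfolding saturated_chain_def by metis
    then show ?thesis using covered_by_lower_upper_path UL k(1) by metis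
  qed
  have "?f x \<in> lpm_poset n" if "x \<in> set xs" for x
  proof -
    obtain U L where UL: "path_pair n U L" "k \<notin> U" "x = lpm n U L" using elem[OF \<open>x \<in> set xs\<close>] by blast
    then show ?thesis using lpm_in_poset[OF path_pair_step_down] lower_upper_path_lpm k(1) by simp
  qed
  then have "saturated_chain n (map ?f xs)"
    using step ne unfolding saturated_chain_def by auto
  moreover have "hd (map ?f xs) = lpm n {} {}"
    using ne hd lower_upper_path_lpm[of n "{}" "{}" k] by (simp add: hd_map path_pair_iff ht_def)
  moreover have "last (map ?f xs) = lpm n ({1..n} - {Suc k}) ({1..n} - {1})"
  proof -
    \<comment> \<open>Here \<open>k + 1\<close> moves into the gap at \<open>k\<close> and leaves a
      gap at \<open>k + 1\<close>, so the top of one interval is sent to the top of the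
      next.\<close>
    have "step_down k ` ({1..n} - {k}) = {1..n} - {Suc k}"
      using k by (auto simp: step_down_def image_iff)
    then show ?thesis
      using ne last lower_upper_path_lpm[OF path_pair_coatom[of k n]] k by (simp add: last_map)
  qed
  moreover have "falling n (map ?f xs)"
    unfolding falling_def
  proof (intro allI impI)
    fix i assume "Suc (Suc i) < length (map ?f xs)"
    then have i: "Suc i < length xs" "Suc (Suc i) < length xs" by simp_all
    obtain l u where 1: "u \<noteq> k" "cover_label n (xs ! i) (xs ! Suc i) = (l, u)"
      "cover_label n (?f (xs ! i)) (?f (xs ! Suc i)) = (l, step_down k u)" using step[OF i(1)] by blast
    obtain l' u' where 2: "u' \<noteq> k" "cover_label n (xs ! Suc i) (xs ! Suc (Suc i)) = (l', u')"
      "cover_label n (?f (xs ! Suc i)) (?f (xs ! Suc (Suc i))) = (l', step_down k u')" using step[OF i(2)] by blast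
    have "\<not> (l < l' \<and> u < u')" using fall i(2) 1(2) 2(2) unfolding falling_def by fastforce
    then show "let (l, u) = cover_label n (map ?f xs ! i) (map ?f xs ! Suc i);
             (l', u') = cover_label n (map ?f xs ! Suc i) (map ?f xs ! Suc (Suc i))
         in \<not> (l < l' \<and> u < u')"
      using i 1(3) 2(3) step_down_less_iff[OF 1(1) 2(1)] by simp
  qed
  ultimately show ?thesis by (simp add: FC_def maximal_chains_def)
qed

lemma card_FC_le_Suc:
  assumes k: "1 \<le> k" "Suc k \<le> n"
  shows "card (FC n k) \<le> card (FC n (Suc k))"
proof (rule card_inj_on_le)
  show "inj_on (map (lower_upper_path n k)) (FC n k)"
  proof (rule inj_onI)
    fix xs ys assume "xs \<in> FC n k" "ys \<in> FC n k"
      and eq: "map (lower_upper_path n k) xs = map (lower_upper_path n k) ys"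
    then have "set xs \<union> set ys \<subseteq> {lpm n U L |U L. path_pair n U L \<and> k \<notin> U}"
      using FC_elements[of k n] k by simp
    then have "inj_on (lower_upper_path n k) (set xs \<union> set ys)"
      using inj_on_lower_upper_path[OF k(1)] inj_on_subset by blast
    then show "xs = ys" using map_inj_on[OF eq] by blast
  qed
qed (use map_lower_upper_path_FC finite_FC k in auto)

theorem theorem3p11:
  fixes n a b :: nat
  assumes "n \<ge> 2" and "a \<in> {1..n}" and "b \<in> {1..n}" and "a \<ge> b"
  shows "card (FC n a) \<ge> card (FC n b)"
  using assms(4,2)
proof (induction a rule: dec_induct)
  case (step m)
  then show ?case using card_FC_le_Suc[of m n] assms(3) by simp
qed simp

end
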